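(* For any finite connected weighted graph with vertex measure $(G,\mu)$ satisfying the curvature-dimension inequality $CD(0,\infty)$ and any natural number $k$ with $2\le k\le |V|$, we have $$\lambda_k(G,\mu)\le\left(\frac{20\sqrt{2}\,e}{e-1}\right)^2 D_G^{non}D_G^{nor}\,k^2\,\lambda_2(G,\mu).$$
   Context: $G=(V,E,w)$ is an undirected finite connected weighted graph with vertex set $V$, edge set $E$, adjacency relation $\sim$, and symmetric edge weights $w:V\times V\to\mathbb{R}_{\ge 0}$ with $w_{xy}=w_{yx}>0$ if and only if $x\sim y$; $\mu:V\to\mathbb{R}_{>0}$ is a positive vertex measure. The Laplacian is $\Delta f(x)=\frac{1}{\mu(x)}\sum_{y,y\sim x}w_{xy}(f(y)-f(x))$ for $f:V\to\mathbb{R}$. The eigenvalues (numbers $\lambda$ such that $\Delta f+\lambda f=0$ has a nonzero solution $f$) are ordered with multiplicity as $0=\lambda_1(G,\mu)<\lambda_2(G,\mu)\le\cdots\le\lambda_{|V|}(G,\mu)$. $D_G^{non}:=\max_{x\in V}\frac{\sum_{y,y\sim x}w_{xy}}{\mu(x)}$ and $D_G^{nor}:=\max_{x\in V}\max_{y,y\sim x}\frac{\mu(x)}{w_{xy}}$. Define $\Gamma(f,g):=\frac12\{\Delta(fg)-f\Delta g-g\Delta f\}$, $\Gamma_2(f,g):=\frac12\{\Delta\Gamma(f,g)-\Gamma(f,\Delta g)-\Gamma(g,\Delta f)\}$, and $\Gamma_2(f):=\Gamma_2(f,f)$. $(G,\mu)$ satisfies $CD(0,\infty)$ if $\Gamma_2(f)(x)\ge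 0$ for all $f:V\to\mathbb{R}$ and all $x\in V$. *)

theory Defs
  imports "HOL-Analysis.Analysis"
begin

text \<open>The vertex set is the universe of a finite type \<open>'v\<close>. The weight vanishes off the
  edges; loops are not excluded (they do not contribute to the Laplacian).\<close>

locale connected_weighted_graph =
  fixes adj :: "'v::finite \<Rightarrow> 'v \<Rightarrow> bool"
    and w :: "'v \<Rightarrow> 'v \<Rightarrow> real"
    and \<mu> :: "'v \<Rightarrow> real"
  assumes w_nonneg: "0 \<le> w x y"
    and w_sym: "w x y = w y x"
    and w_pos_iff: "0 < w x y \<longleftrightarrow> adj x y"
    and connected: "adj\<^sup>*\<^sup>* x y"
    and \<mu>_pos: "0 < \<mu> x"

type_synonym 'v operator = "('v \<Rightarrow> real) \<Rightarrow> ('v \<Rightarrow> real)"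

definition laplacian ::
  "('v::finite \<Rightarrow> 'v \<Rightarrow> bool) \<Rightarrow> ('v \<Rightarrow> 'v \<Rightarrow> real) \<Rightarrow> ('v \<Rightarrow> real) \<Rightarrow> 'v operator" where
  "laplacian adj w \<mu> f x = 1 / \<mu> x * (\<Sum>y\<in>{y. adj y x}. w x y * (f y - f x))"

definition gamma :: "'v operator \<Rightarrow> ('v \<Rightarrow> real) \<Rightarrow> 'v operator" where
  "gamma L f g x = 1 / 2 * (L (\<lambda>y. f y * g y) x - f x * L g x - g x * L f x)"

definition gamma2 :: "'v operator \<Rightarrow> ('v \<Rightarrow> real) \<Rightarrow> 'v operator" where
  "gamma2 L f g x = 1 / 2 * (L (gamma L f g) x - gamma L f (L g) x - gamma L g (L f) x)"

definition CD_0_infinity ::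
  "('v::finite \<Rightarrow> 'v \<Rightarrow> bool) \<Rightarrow> ('v \<Rightarrow> 'v \<Rightarrow> real) \<Rightarrow> ('v \<Rightarrow> real) \<Rightarrow> bool" where
  "CD_0_infinity adj w \<mu> \<longleftrightarrow> (\<forall>f x. 0 \<le> gamma2 (laplacian adj w \<mu>) f f x)"

definition D_non ::
  "('v::finite \<Rightarrow> 'v \<Rightarrow> bool) \<Rightarrow> ('v \<Rightarrow> 'v \<Rightarrow> real) \<Rightarrow> ('v \<Rightarrow> real) \<Rightarrow> real" where
  "D_non adj w \<mu> = (MAX x\<in>UNIV. (\<Sum>y\<in>{y. adj y x}. w x y) / \<mu> x)"

text \<open>The inner maximum is over a nonempty set as soon as a connected graph has at least two
  vertices.\<close>

definition D_nor ::
  "('v::finite \<Rightarrow> 'v \<Rightarrow> bool) \<Rightarrow> ('v \<Rightarrow> 'v \<Rightarrow> real) \<Rightarrow> ('v \<Rightarrow> real) \<Rightarrow> real" where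
  "D_nor adj w \<mu> = (MAX x\<in>UNIV. MAX y\<in>{y. adj y x}. \<mu> x / w x y)"

text \<open>Functions on the vertices are taken in \<open>real ^ 'v\<close> here, so that \<open>dim\<close> applies.\<close>

definition eigenspace ::
  "('v::finite \<Rightarrow> 'v \<Rightarrow> bool) \<Rightarrow> ('v \<Rightarrow> 'v \<Rightarrow> real) \<Rightarrow> ('v \<Rightarrow> real) \<Rightarrow> real \<Rightarrow> (real ^ 'v) set" where
  "eigenspace adj w \<mu> l = {f. \<forall>x. laplacian adj w \<mu> (\<lambda>y. f $ y) x + l * f $ x = 0}"

definition eigenvalues ::
  "('v::finite \<Rightarrow> 'v \<Rightarrow> bool) \<Rightarrow> ('v \<Rightarrow> 'v \<Rightarrow> real) \<Rightarrow> ('v \<Rightarrow> real) \<Rightarrow> real set" where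
  "eigenvalues adj w \<mu> = {l. \<exists>f \<in> eigenspace adj w \<mu> l. f \<noteq> 0}"

text \<open>Each eigenvalue is repeated according to the dimension of its eigenspace, in
  nondecreasing order. As the Laplacian is self-adjoint for the inner product weighted by
  \<open>\<mu>\<close>, the spectrum is finite and this list has \<open>CARD('v)\<close> entries for every
  weighted graph.\<close>

definition eigenvalue_list ::
  "('v::finite \<Rightarrow> 'v \<Rightarrow> bool) \<Rightarrow> ('v \<Rightarrow> 'v \<Rightarrow> real) \<Rightarrow> ('v \<Rightarrow> real) \<Rightarrow> real list" where
  "eigenvalue_list adj w \<mu> =
     concat (map (\<lambda>l. replicate (dim (eigenspace adj w \<mu> l)) l)
       (sorted_list_of_set (eigenvalues adj w \<mu>)))"

text \<open>Numbered from \<open>k = 1\<close>, so that \<open>eigenvalue adj w \<mu> 1 = 0\<close>.\<close>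

definition eigenvalue ::
  "('v::finite \<Rightarrow> 'v \<Rightarrow> bool) \<Rightarrow> ('v \<Rightarrow> 'v \<Rightarrow> real) \<Rightarrow> ('v \<Rightarrow> real) \<Rightarrow> nat \<Rightarrow> real" where
  "eigenvalue adj w \<mu> k = eigenvalue_list adj w \<mu> ! (k - 1)"

end

theory Submission imports Defs begin

text \<open>
  Let \<open>f\<close> be an eigenfunction for \<open>\<lambda>\<^sub>2\<close> whose sign is chosen such that \<open>{f > 0}\<close> has at most half
  of the total measure, and let \<open>\<phi>\<close> be the least ratio of boundary weight to measure among the
  nonempty subsets of \<open>{f > 0}\<close>. The theorem follows by eliminating \<open>\<phi>\<close> from two inequalities.

  The first is Buser's inequality (\<open>buser\<close>), a lower bound for \<open>\<phi>\<close> by a multiple of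
  \<open>\<surd>(\<lambda>\<^sub>2 / D_nor)\<close>. Heat starting from the indicator of \<open>A\<close> loses a definite part of its mass from
  \<open>A\<close> within the time \<open>1 / \<lambda>\<^sub>2\<close>, by the spectral gap. Under \<open>CD(0, \<infinity>)\<close> the gradient at time \<open>t\<close> is
  at most of order \<open>1 / \<surd>t\<close>, which limits the flow through the boundary of \<open>A\<close>. The heat flow is
  replaced by implicit Euler steps, for which the gradient bound
  (\<open>euler_sequence_gradient_bound\<close>) follows from the maximum principle, and the step size tends to
  \<open>0\<close> at the end.

  The second is an improved Cheeger inequality (\<open>improved_cheeger\<close>), an upper bound for \<open>\<phi>\<close> by
  \<open>10 k \<lambda>\<^sub>2 \<surd>(2 D_non / \<lambda>\<^sub>k)\<close>. The positive part of \<open>f\<close> has Rayleigh quotient at most \<open>\<lambda>\<^sub>2\<close>. If it were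
  far from all step functions with about \<open>2 k\<close> values, it could be cut into \<open>k\<close> functions with
  disjoint supports and small Rayleigh quotients, against the Courant-Fischer characterisation of
  \<open>\<lambda>\<^sub>k\<close> (\<open>thresholds_with_small_error\<close>). Near a step function, level sets cut at places where \<open>f\<close>
  takes few values are cheap, and one of them has a small boundary.

  Together, \<open>c \<surd>(\<lambda>\<^sub>2 / D_nor) \<le> 10 k \<lambda>\<^sub>2 \<surd>(2 D_non / \<lambda>\<^sub>k)\<close> with \<open>c = (1 - 1 / e) / 2\<close>, and squaring
  gives the claim.
\<close>

section \<open>Spectral theorem and Courant-Fischer for self-adjoint operators\<close>

text \<open>A maximiser of the Rayleigh quotient on the unit sphere of \<open>W\<close> is an eigenvector, because the
  quotient is stationary there.\<close>

lemma selfadjoint_has_eigenvector: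
  fixes S :: "'a::euclidean_space \<Rightarrow> 'a"
  assumes lin: "linear S" and sym: "\<And>x y. S x \<bullet> y = x \<bullet> S y"
    and W: "subspace W" and inv: "\<And>x. x \<in> W \<Longrightarrow> S x \<in> W" and nt: "W \<noteq> {0}"
  obtains v c where "v \<in> W" "norm v = 1" "S v = c *\<^sub>R v"
proof -
  interpret S: linear S by fact
  let ?K = "W \<inter> sphere 0 1"
  have "compact ?K" using closed_subspace[OF W] by (simp add: closed_Int_compact)
  moreover have "?K \<noteq> {}"
  proof -
    obtain x where x: "x \<in> W" "x \<noteq> 0" using nt subspace_0[OF W] by blast
    have "(1 / norm x) *\<^sub>R x \<in> ?K" using x W by (simp add: subspace_scale)
    then show ?thesis by blast
  qed
  moreover have "continuous_on ?K (\<lambda>x. S x \<bullet> x)"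
    using linear_continuous_on[of S] lin linear_conv_bounded_linear
    by (intro continuous_intros) blast
  ultimately have "\<exists>v\<in>?K. \<forall>x\<in>?K. S x \<bullet> x \<le> S v \<bullet> v"
    by (rule continuous_attains_sup)
  then obtain v where v: "v \<in> ?K" and max: "\<And>x. x \<in> ?K \<Longrightarrow> S x \<bullet> x \<le> S v \<bullet> v"
    by blast
  define c where "c = S v \<bullet> v"
  have nv: "v \<bullet> v = 1" using v by (simp add: norm_eq_1)
  have le: "S x \<bullet> x \<le> c * (x \<bullet> x)" if "x \<in> W" for x
  proof (cases "x = 0")
    case True then show ?thesis by (simp add: S.zero)
  next
    case False
    have "S ((1 / norm x) *\<^sub>R x) \<bullet> ((1 / norm x) *\<^sub>R x) \<le> c"
      unfolding c_def using that W False by (intro max) (simp add: subspace_scale)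
    then have "(S x \<bullet> x) / (norm x)\<^sup>2 \<le> c"
      by (simp add: S.scale power2_eq_square)
    then show ?thesis using False by (simp add: field_simps power2_norm_eq_inner)
  qed
  define r where "r = S v - c *\<^sub>R v"
  have rW: "r \<in> W" unfolding r_def using v inv W by (simp add: subspace_diff subspace_scale)
  define q where "q = c * (r \<bullet> r) - S r \<bullet> r"
  \<comment> \<open>The quadratic form \<open>c |x|\<^sup>2 - \<langle>S x, x\<rangle>\<close> is nonnegative on \<open>W\<close> and vanishes at \<open>v\<close>, so
    its derivative at \<open>v\<close> in the direction of the residual \<open>r\<close>, which is \<open>-2 |r|\<^sup>2\<close>, vanishes.\<close>
  have quad: "2 * t * (r \<bullet> r) \<le> t\<^sup>2 * q" for t
  proof -
    have "v + t *\<^sub>R r \<in> W" using v rW W by (simp add: subspace_add subspace_scale)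
    from le[OF this] have "S v \<bullet> v + 2 * t * (S v \<bullet> r) + t\<^sup>2 * (S r \<bullet> r)
        \<le> c * (v \<bullet> v + 2 * t * (v \<bullet> r) + t\<^sup>2 * (r \<bullet> r))"
      using sym[of r v]
      by (simp add: S.add S.scale algebra_simps inner_simps power2_eq_square inner_commute)
    moreover have "S v \<bullet> r = r \<bullet> r + c * (v \<bullet> r)"
      using inner_diff_left[of "S v" "c *\<^sub>R v" r] by (simp add: r_def)
    ultimately have "c + 2 * t * (r \<bullet> r + c * (v \<bullet> r)) + t\<^sup>2 * (S r \<bullet> r)
        \<le> c * (1 + 2 * t * (v \<bullet> r) + t\<^sup>2 * (r \<bullet> r))"
      using nv c_def by simp
    then show ?thesis unfolding q_def by (simp add: algebra_simps)
  qed
  have "r \<bullet> r = 0"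
  proof (rule ccontr)
    assume "r \<bullet> r \<noteq> 0"
    then have pos: "r \<bullet> r > 0" by simp
    define t where "t = (r \<bullet> r) / (\<bar>q\<bar> + 1)"
    have t: "t > 0" unfolding t_def using pos by (simp add: add_nonneg_pos)
    have "t * q \<le> t * (\<bar>q\<bar> + 1)" using t by (intro mult_left_mono) auto
    also have "\<dots> = r \<bullet> r" unfolding t_def by (simp add: add_nonneg_pos order_less_imp_not_eq2)
    finally have "t * (t * q) \<le> t * (r \<bullet> r)" using t by simp
    then have "2 * (t * (r \<bullet> r)) \<le> t * (r \<bullet> r)" using quad[of t] by (simp add: power2_eq_square)
    then show False using mult_pos_pos[OF t pos] by linarith
  qed
  then have "S v = c *\<^sub>R v" unfolding r_def by simp
  then show thesis using v by (intro that[of v c]) auto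
qed

text \<open>An orthonormal set of eigenvectors of the largest possible size must span: its orthogonal
  complement is invariant under \<open>S\<close>, so a nonzero complement would contain another eigenvector.\<close>

lemma selfadjoint_orthonormal_eigenbasis:
  fixes S :: "'a::euclidean_space \<Rightarrow> 'a"
  assumes lin: "linear S" and sym: "\<And>x y. S x \<bullet> y = x \<bullet> S y"
  obtains B ev where "pairwise orthogonal B" "\<And>b. b \<in> B \<Longrightarrow> norm b = 1" "span B = UNIV"
    "\<And>b. b \<in> B \<Longrightarrow> S b = ev b *\<^sub>R b"
proof -
  interpret S: linear S by fact
  define Q where "Q B \<longleftrightarrow> pairwise orthogonal B \<and> (\<forall>b\<in>B. norm b = 1 \<and> (\<exists>c. S b = c *\<^sub>R b))" for B
  have ind: "independent B" if "Q B" for B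
    using that unfolding Q_def by (intro pairwise_orthogonal_independent) auto
  have bd: "card B < Suc DIM('a)" if "Q B" for B
    using ind[OF that] independent_bound le_imp_less_Suc by blast
  have "Q {}" by (simp add: Q_def)
  then obtain B where B: "Q B" and max: "\<And>C. Q C \<Longrightarrow> card C \<le> card B"
    using ex_has_greatest_nat[of Q "{}" card "Suc DIM('a)"] bd by blast
  have "\<forall>b\<in>B. \<exists>c. S b = c *\<^sub>R b" using B unfolding Q_def by simp
  then obtain ev where ev: "\<And>b. b \<in> B \<Longrightarrow> S b = ev b *\<^sub>R b" by metis
  have "span B = UNIV"
  proof (rule ccontr)
    assume *: "span B \<noteq> UNIV"
    define W where "W = {x. \<forall>y\<in>B. orthogonal x y}"
    have W: "subspace W" unfolding W_def subspace_def orthogonal_def by (simp add: inner_simps)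
    have inv: "S x \<in> W" if "x \<in> W" for x
    proof -
      have "S x \<bullet> b = 0" if "b \<in> B" for b
      proof -
        have "x \<bullet> b = 0" using \<open>x \<in> W\<close> that unfolding W_def orthogonal_def by simp
        then show ?thesis using sym[of x b] ev[OF that] by simp
      qed
      then show ?thesis unfolding W_def orthogonal_def by simp
    qed
    have "dim B < DIM('a)" using * dim_eq_full[of B] dim_subset_UNIV[of B] by linarith
    then obtain x where x: "x \<noteq> 0" "\<And>y. y \<in> span B \<Longrightarrow> orthogonal x y"
      by (metis orthogonal_to_subspace_exists)
    then have "x \<in> W" unfolding W_def by (simp add: span_base)
    then have "W \<noteq> {0}" using x(1) by (metis singletonD)
    from selfadjoint_has_eigenvector[OF lin sym W inv this]
    obtain v c where v: "v \<in> W" "norm v = 1" "S v = c *\<^sub>R v" by metis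
    have "v \<notin> B"
    proof
      assume "v \<in> B"
      then have "v \<bullet> v = 0" using v(1) unfolding W_def orthogonal_def by simp
      then show False using v(2) by simp
    qed
    moreover have "finite B" using ind[OF B] independent_bound by blast
    moreover have "Q (insert v B)"
      using B v unfolding Q_def W_def
      by (auto simp: pairwise_insert orthogonal_def inner_commute)
    ultimately show False using max[of "insert v B"] by simp
  qed
  moreover have "pairwise orthogonal B" "\<And>b. b \<in> B \<Longrightarrow> norm b = 1" using B unfolding Q_def by simp_all
  ultimately show thesis by (intro that[OF _ _ _ ev])
qed

text \<open>The eigenvalues of \<open>S\<close> with multiplicity are the values of \<open>ev\<close> on the basis \<open>B\<close>; the
  following locale relates them to dimensions of eigenspaces and to Rayleigh quotients.\<close>

locale orthonormal_eigenbasis =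
  fixes S :: "'a::euclidean_space \<Rightarrow> 'a" and B :: "'a set" and ev :: "'a \<Rightarrow> real"
  assumes linear_S: "linear S"
    and orth: "pairwise orthogonal B" and norm1: "b \<in> B \<Longrightarrow> norm b = 1"
    and span_B: "span B = UNIV" and eig: "b \<in> B \<Longrightarrow> S b = ev b *\<^sub>R b"
begin

sublocale S: linear S by (rule linear_S)

lemma independent_B: "independent B"
  using orth norm1[of 0] by (intro pairwise_orthogonal_independent) auto

lemma finite_B: "finite B"
  using independent_B independent_bound by blast

lemma card_B: "card B = DIM('a)"
  using dim_span_eq_card_independent[OF independent_B] span_B by simp

lemma sum_inner: "C \<subseteq> B \<Longrightarrow> (\<Sum>b\<in>C. f b *\<^sub>R b) \<bullet> (\<Sum>b\<in>C. g b *\<^sub>R b) = (\<Sum>b\<in>C. f b * g b)"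
proof -
  assume C: "C \<subseteq> B"
  have fin: "finite C" using C finite_B finite_subset by blast
  have "(\<Sum>b\<in>C. f b *\<^sub>R b) \<bullet> (\<Sum>b\<in>C. g b *\<^sub>R b) = (\<Sum>b\<in>C. \<Sum>d\<in>C. f b * g d * (b \<bullet> d))"
    by (simp add: inner_sum_left inner_sum_right sum_distrib_left algebra_simps)
      (rule sum.swap)
  also have "\<dots> = (\<Sum>b\<in>C. \<Sum>d\<in>C. if d = b then f b * g b else 0)"
  proof (intro sum.cong refl)
    fix b d assume bd: "b \<in> C" "d \<in> C"
    show "f b * g d * (b \<bullet> d) = (if d = b then f b * g b else 0)"
    proof (cases "d = b")
      case True then show ?thesis using norm1 bd C by (simp add: subset_iff norm_eq_1)
    next
      case False then show ?thesis using orth bd C unfolding pairwise_def orthogonal_def by force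
    qed
  qed
  also have "\<dots> = (\<Sum>b\<in>C. f b * g b)" using fin by simp
  finally show ?thesis .
qed

lemma S_sum: "C \<subseteq> B \<Longrightarrow> S (\<Sum>b\<in>C. u b *\<^sub>R b) = (\<Sum>b\<in>C. (ev b * u b) *\<^sub>R b)"
  by (auto simp: S.sum S.scale eig intro!: sum.cong)

lemma in_span_cases:
  assumes "C \<subseteq> B" "x \<in> span C" obtains u where "x = (\<Sum>b\<in>C. u b *\<^sub>R b)"
  using assms span_finite[of C] finite_subset[OF assms(1) finite_B] by auto

lemma dim_eigenspace: "dim {x. S x = l *\<^sub>R x} = card {b\<in>B. ev b = l}"
proof -
  let ?C = "{b\<in>B. ev b = l}"
  have "{x. S x = l *\<^sub>R x} = span ?C"
  proof
    show "span ?C \<subseteq> {x. S x = l *\<^sub>R x}"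
    proof
      fix x assume "x \<in> span ?C"
      then obtain u where "x = (\<Sum>b\<in>?C. u b *\<^sub>R b)" using in_span_cases[of ?C] by blast
      then show "x \<in> {x. S x = l *\<^sub>R x}"
        using S_sum[of ?C u] by (auto simp: scaleR_sum_right intro!: sum.cong)
    qed
    show "{x. S x = l *\<^sub>R x} \<subseteq> span ?C"
    proof
      fix x assume "x \<in> {x. S x = l *\<^sub>R x}"
      then have Sx: "S x = l *\<^sub>R x" by simp
      obtain u where u: "x = (\<Sum>b\<in>B. u b *\<^sub>R b)" using in_span_cases[of B x] span_B by blast
      have "(\<Sum>b\<in>B. ((ev b - l) * u b) *\<^sub>R b) = 0"
        using Sx S_sum[of B u] u by (simp add: algebra_simps sum_subtractf scaleR_sum_right)
      then have "(\<Sum>b\<in>B. ((ev b - l) * u b)\<^sup>2) = 0"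
        using sum_inner[of B "\<lambda>b. (ev b - l) * u b" "\<lambda>b. (ev b - l) * u b"]
        by (simp add: power2_eq_square)
      then have z: "u b = 0" if "b \<in> B" "ev b \<noteq> l" for b
        using that finite_B by (auto simp: sum_nonneg_eq_0_iff)
      have "x = (\<Sum>b\<in>?C. u b *\<^sub>R b)"
        unfolding u using finite_B z by (intro sum.mono_neutral_right) auto
      moreover have "(\<Sum>b\<in>?C. u b *\<^sub>R b) \<in> span ?C"
        by (intro span_sum span_scale span_base)
      ultimately show "x \<in> span ?C" by metis
    qed
  qed
  moreover have "independent ?C" by (rule independent_mono[OF independent_B]) auto
  ultimately show ?thesis using dim_span_eq_card_independent[of ?C] by simp
qed

text \<open>The half of the Courant-Fischer principle that bounds eigenvalues from above. On the span of the
  eigenvectors with eigenvalue above \<open>c\<close> the Rayleigh quotient exceeds \<open>c\<close>, so \<open>W\<close> meets it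
  only in \<open>0\<close>, and the dimensions of the two subspaces add up to at most the total.\<close>

lemma dim_le_card_eigenvalues_le:
  assumes W: "subspace W" and le: "\<And>x. x \<in> W \<Longrightarrow> S x \<bullet> x \<le> c * (x \<bullet> x)"
  shows "dim W \<le> card {b\<in>B. ev b \<le> c}"
proof -
  let ?C = "{b\<in>B. \<not> ev b \<le> c}"
  have "x = 0" if x: "x \<in> span ?C" "x \<in> W" for x
  proof -
    obtain u where u: "x = (\<Sum>b\<in>?C. u b *\<^sub>R b)" using in_span_cases[of ?C x] x by blast
    have "S x \<bullet> x = (\<Sum>b\<in>?C. ev b * u b * u b)" unfolding u
      using S_sum[of ?C u] sum_inner[of ?C "\<lambda>b. ev b * u b" u] by simp
    moreover have "x \<bullet> x = (\<Sum>b\<in>?C. u b * u b)" unfolding u using sum_inner[of ?C u u] by simp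
    ultimately have "(\<Sum>b\<in>?C. (ev b - c) * (u b * u b)) \<le> 0"
      using le[OF x(2)] by (simp add: sum_distrib_left algebra_simps sum_subtractf)
    moreover have nn: "(ev b - c) * (u b * u b) \<ge> 0" if "b \<in> ?C" for b using that by simp
    ultimately have "(\<Sum>b\<in>?C. (ev b - c) * (u b * u b)) = 0"
      by (meson order_antisym sum_nonneg)
    then have "\<forall>b\<in>?C. (ev b - c) * (u b * u b) = 0"
      using sum_nonneg_eq_0_iff[of ?C, OF _ nn] finite_B by simp
    then have "\<forall>b\<in>?C. u b = 0" by auto
    then show ?thesis unfolding u by simp
  qed
  then have "span ?C \<inter> W = {0}" using subspace_0[OF W] span_zero by blast
  then have "dim (span ?C \<inter> W) = 0" by simp
  then have "dim (span ?C) + dim W = dim {x + y |x y. x \<in> span ?C \<and> y \<in> W}"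
    using dim_sums_Int[OF subspace_span W, of ?C] by linarith
  then have "dim (span ?C) + dim W \<le> DIM('a)" using dim_subset_UNIV by simp
  moreover have "dim (span ?C) = card ?C"
    by (rule dim_span_eq_card_independent, rule independent_mono[OF independent_B]) auto
  moreover have "card ?C + card {b\<in>B. ev b \<le> c} = card B"
  proof -
    have "B = ?C \<union> {b\<in>B. ev b \<le> c}" by blast
    moreover have "card (?C \<union> {b\<in>B. ev b \<le> c}) = card ?C + card {b\<in>B. ev b \<le> c}"
      using finite_B by (intro card_Un_disjoint) auto
    ultimately show ?thesis by simp
  qed
  ultimately show ?thesis using card_B by linarith
qed

end

section \<open>The list of eigenvalues\<close>

lemma sorted_concat_replicate:
  "sorted xs \<Longrightarrow> sorted (concat (map (\<lambda>l. replicate (d l) l) xs))"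
  by (induction xs) (auto simp: sorted_append)

lemma length_filter_concat_replicate:
  fixes A :: "'a::linorder set"
  assumes "finite A"
  shows "length (filter P (concat (map (\<lambda>l. replicate (d l) l) (sorted_list_of_set A))))
    = (\<Sum>l\<in>{l\<in>A. P l}. d l)"
proof -
  have "length (filter P (concat (map (\<lambda>l. replicate (d l) l) xs)))
      = sum_list (map (\<lambda>l. if P l then d l else 0) xs)" for xs
    by (induction xs) auto
  then have "length (filter P (concat (map (\<lambda>l. replicate (d l) l) (sorted_list_of_set A))))
      = (\<Sum>l\<in>A. if P l then d l else 0)"
    using assms by (simp add: sum_list_distinct_conv_sum_set)
  then show ?thesis using assms by (simp add: sum.inter_filter)
qed

text \<open>Translates a lower bound on the number of entries up to \<open>c\<close> into an upper bound on a single
  entry. The position \<open>k - 1\<close> reflects that eigenvalues are numbered from \<open>1\<close>.\<close>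

lemma sorted_nth_le_if_length_filter:
  assumes "sorted xs" "length (filter (\<lambda>x. x \<le> c) xs) \<ge> k" "1 \<le> k"
  shows "xs ! (k - 1) \<le> c"
proof (rule ccontr)
  assume "\<not> xs ! (k - 1) \<le> c"
  then have "{i. i < length xs \<and> xs ! i \<le> c} \<subseteq> {..<k - 1}"
    using assms(1) by (auto simp: not_le[symmetric] dest: sorted_nth_mono[of xs "k - 1"])
  then have "card {i. i < length xs \<and> xs ! i \<le> c} \<le> k - 1"
    using card_mono[of "{..<k - 1}"] by simp
  then show False using assms by (simp add: length_filter_conv_card)
qed

context connected_weighted_graph
begin

abbreviation lap :: "('v \<Rightarrow> real) \<Rightarrow> 'v \<Rightarrow> real" where "lap \<equiv> laplacian adj w \<mu>"

definition inprod :: "('v \<Rightarrow> real) \<Rightarrow> ('v \<Rightarrow> real) \<Rightarrow> real" where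
  "inprod f g = (\<Sum>x\<in>UNIV. \<mu> x * f x * g x)"

definition energy :: "('v \<Rightarrow> real) \<Rightarrow> ('v \<Rightarrow> real) \<Rightarrow> real" where
  "energy f g = (\<Sum>x\<in>UNIV. \<Sum>y\<in>UNIV. w x y * ((f x - f y) * (g x - g y))) / 2"

lemma sum_adj: "(\<Sum>y\<in>{y. adj y x}. w x y * F y) = (\<Sum>y\<in>UNIV. w x y * F y)"
proof (rule sum.mono_neutral_left)
  show "\<forall>y\<in>UNIV - {y. adj y x}. w x y * F y = 0"
    using w_pos_iff w_sym w_nonneg by (metis DiffE mem_Collect_eq mult_eq_0_iff order_le_less)
qed auto

lemma lap_eq: "lap f x = (\<Sum>y\<in>UNIV. w x y * (f y - f x)) / \<mu> x"
  by (simp add: laplacian_def sum_adj)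

lemma mu_lap: "\<mu> x * lap f x = (\<Sum>y\<in>UNIV. w x y * (f y - f x))"
  using \<mu>_pos[of x] by (simp add: lap_eq)

lemma swap_w: "(\<Sum>x\<in>UNIV. \<Sum>y\<in>UNIV. w x y * F x y) = (\<Sum>x\<in>UNIV. \<Sum>y\<in>UNIV. w x y * F y x)"
  by (subst sum.swap) (simp add: w_sym)

text \<open>Green's formula. Symmetrising over the two ends of an edge yields the factor \<open>1 / 2\<close> in \<open>energy\<close>.\<close>

lemma inprod_lap: "inprod (lap f) g = - energy f g"
proof -
  have "inprod (lap f) g = (\<Sum>x\<in>UNIV. \<Sum>y\<in>UNIV. w x y * ((f y - f x) * g x))"
    unfolding inprod_def by (simp add: mu_lap sum_distrib_right mult.assoc)
  moreover from this
  have "inprod (lap f) g = (\<Sum>x\<in>UNIV. \<Sum>y\<in>UNIV. w x y * ((f x - f y) * g y))"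
    using swap_w[of "\<lambda>x y. (f y - f x) * g x"] by simp
  ultimately have "2 * inprod (lap f) g
      = (\<Sum>x\<in>UNIV. \<Sum>y\<in>UNIV. w x y * ((f y - f x) * g x) + w x y * ((f x - f y) * g y))"
    by (simp add: sum.distrib)
  also have "\<dots> = (\<Sum>x\<in>UNIV. \<Sum>y\<in>UNIV. - (w x y * ((f x - f y) * (g x - g y))))"
    by (intro sum.cong refl) (simp add: algebra_simps)
  also have "\<dots> = - 2 * energy f g" by (simp add: energy_def sum_negf)
  finally show ?thesis by simp
qed

lemma energy_sym: "energy f g = energy g f"
  by (simp add: energy_def mult.commute)

lemma inprod_sym: "inprod f g = inprod g f"
  by (simp add: inprod_def mult_ac)

lemma energy_nonneg: "energy f f \<ge> 0"
  unfolding energy_def using w_nonneg by (auto intro!: sum_nonneg)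

lemma inprod_pos: "f x \<noteq> 0 \<Longrightarrow> inprod f f > 0"
  unfolding inprod_def mult.assoc using \<mu>_pos
  by (intro sum_pos2[of _ x]) (auto simp: less_imp_le zero_less_mult_iff linorder_neq_iff)

lemma inprod_nonneg: "inprod f f \<ge> 0"
  unfolding inprod_def using \<mu>_pos
  by (intro sum_nonneg) (auto simp: mult.assoc less_imp_le)

text \<open>Conjugation by \<open>\<surd>\<mu>\<close> turns the inner product weighted by \<open>\<mu>\<close> into the standard one and
  the negative Laplacian into a self-adjoint operator in the usual sense.\<close>

definition unscale :: "real ^ 'v \<Rightarrow> real ^ 'v" where
  "unscale f = (\<chi> x. f $ x / sqrt (\<mu> x))"

definition symlap :: "real ^ 'v \<Rightarrow> real ^ 'v" where
  "symlap f = (\<chi> x. - sqrt (\<mu> x) * lap (\<lambda>y. unscale f $ y) x)"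

lemma linear_unscale: "linear unscale"
  by (rule linearI) (simp_all add: unscale_def vec_eq_iff add_divide_distrib)

lemma inj_unscale: "inj unscale"
proof (rule injI)
  fix f g assume "unscale f = unscale g"
  then show "f = g" using \<mu>_pos by (auto simp: unscale_def vec_eq_iff less_imp_neq[symmetric])
qed

lemma lap_add: "lap (\<lambda>y. f y + g y) x = lap f x + lap g x"
  by (simp add: lap_eq add_divide_distrib[symmetric] sum.distrib[symmetric] algebra_simps)

lemma lap_scale: "lap (\<lambda>y. c * f y) x = c * lap f x"
  by (simp add: lap_eq sum_distrib_left algebra_simps)

lemma linear_symlap: "linear symlap"
proof (rule linearI)
  fix f g c
  show "symlap (f + g) = symlap f + symlap g"
    by (simp add: symlap_def linear_add[OF linear_unscale] vec_eq_iff lap_add algebra_simps)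
  show "symlap (c *\<^sub>R f) = c *\<^sub>R symlap f"
    by (simp add: symlap_def linear_scale[OF linear_unscale] vec_eq_iff lap_scale)
qed

lemma inner_unscale: "f \<bullet> g = inprod (\<lambda>x. unscale f $ x) (\<lambda>x. unscale g $ x)"
proof -
  have "\<mu> x * (f $ x / sqrt (\<mu> x)) * (g $ x / sqrt (\<mu> x)) = f $ x * g $ x" for x
    using \<mu>_pos[of x] by (simp add: field_simps)
  then show ?thesis by (simp add: inner_vec_def inprod_def unscale_def)
qed

lemma symlap_inner: "symlap f \<bullet> g = energy (\<lambda>x. unscale f $ x) (\<lambda>x. unscale g $ x)"
proof -
  have "sqrt (\<mu> x) * a * b = \<mu> x * a * (b / sqrt (\<mu> x))" for x a b
    using \<mu>_pos[of x] by (simp add: field_simps flip: real_sqrt_mult)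
  then have "symlap f \<bullet> g = - inprod (lap (\<lambda>x. unscale f $ x)) (\<lambda>x. unscale g $ x)"
    by (simp add: inner_vec_def inprod_def symlap_def unscale_def[of g] sum_negf)
  then show ?thesis by (simp add: inprod_lap)
qed

lemma eigenspace_eq: "eigenspace adj w \<mu> l = unscale ` {f. symlap f = l *\<^sub>R f}"
proof -
  have iff: "(unscale f \<in> eigenspace adj w \<mu> l) \<longleftrightarrow> symlap f = l *\<^sub>R f" for f
  proof -
    have "a + l * unscale f $ x = 0 \<longleftrightarrow> - (sqrt (\<mu> x) * a) = l * f $ x" for x a
      using \<mu>_pos[of x] by (auto simp: field_simps unscale_def)
    then show ?thesis by (simp add: eigenspace_def symlap_def vec_eq_iff)
  qed
  have "surj unscale" using linear_unscale inj_unscale by (rule linear_injective_imp_surjective) (rule refl)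
  show ?thesis
  proof (intro set_eqI iffI)
    fix f assume f: "f \<in> eigenspace adj w \<mu> l"
    obtain g where "f = unscale g" using \<open>surj unscale\<close> by (auto simp: surj_def)
    then show "f \<in> unscale ` {f. symlap f = l *\<^sub>R f}" using f iff[of g] by simp
  qed (auto simp only: iff)
qed

lemma eigenbasis_exists: "\<exists>B ev. orthonormal_eigenbasis symlap B ev"
proof -
  have "symlap f \<bullet> g = f \<bullet> symlap g" for f g
    using symlap_inner[of f g] symlap_inner[of g f] by (simp add: energy_sym inner_commute)
  from selfadjoint_orthonormal_eigenbasis[OF linear_symlap this] show ?thesis
    by (metis linear_symlap orthonormal_eigenbasis.intro)
qed

lemma eigenvalues_eq:
  assumes "orthonormal_eigenbasis symlap B ev"
  shows "eigenvalues adj w \<mu> = ev ` B"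
proof -
  interpret orthonormal_eigenbasis symlap B ev by fact
  have "l \<in> eigenvalues adj w \<mu> \<longleftrightarrow> l \<in> ev ` B" for l
  proof -
    have "l \<in> eigenvalues adj w \<mu> \<longleftrightarrow> (\<exists>f. symlap f = l *\<^sub>R f \<and> f \<noteq> 0)"
      unfolding eigenvalues_def eigenspace_eq
      using linear_injective_0[OF linear_unscale] inj_unscale linear_0[OF linear_unscale] by auto
    also have "\<dots> \<longleftrightarrow> \<not> {f. symlap f = l *\<^sub>R f} \<subseteq> {0}" by auto
    also have "\<dots> \<longleftrightarrow> dim {f. symlap f = l *\<^sub>R f} \<noteq> 0" by (simp add: dim_eq_0)
    also have "\<dots> \<longleftrightarrow> l \<in> ev ` B" using finite_B by (auto simp: dim_eigenspace)
    finally show ?thesis .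
  qed
  then show ?thesis by (rule set_eqI)
qed

lemma dim_eigenspace_eq:
  assumes "orthonormal_eigenbasis symlap B ev"
  shows "dim (eigenspace adj w \<mu> l) = card {b\<in>B. ev b = l}"
proof -
  have "inj_on unscale (span {f. symlap f = l *\<^sub>R f})"
    using inj_unscale by (rule inj_on_subset) simp
  with linear_unscale
  have "dim (unscale ` {f. symlap f = l *\<^sub>R f}) = dim {f. symlap f = l *\<^sub>R f}"
    by (rule dim_image_eq)
  also have "\<dots> = card {b\<in>B. ev b = l}"
    using assms by (rule orthonormal_eigenbasis.dim_eigenspace)
  finally show ?thesis by (simp only: eigenspace_eq)
qed

lemma finite_eigenvalues: "finite (eigenvalues adj w \<mu>)"
proof -
  obtain B ev where B: "orthonormal_eigenbasis symlap B ev" using eigenbasis_exists by blast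
  show ?thesis unfolding eigenvalues_eq[OF B]
    using orthonormal_eigenbasis.finite_B[OF B] by (rule finite_imageI)
qed

lemma sorted_eigenvalue_list: "sorted (eigenvalue_list adj w \<mu>)"
  unfolding eigenvalue_list_def by (intro sorted_concat_replicate) simp

lemma length_filter_eigenvalue_list:
  assumes "orthonormal_eigenbasis symlap B ev"
  shows "length (filter P (eigenvalue_list adj w \<mu>)) = card {b\<in>B. P (ev b)}"
proof -
  interpret orthonormal_eigenbasis symlap B ev by fact
  have "length (filter P (eigenvalue_list adj w \<mu>))
      = (\<Sum>l\<in>{l\<in>ev ` B. P l}. card {b\<in>B. ev b = l})"
    unfolding eigenvalue_list_def length_filter_concat_replicate[OF finite_eigenvalues]
    by (simp add: dim_eigenspace_eq[OF assms] eigenvalues_eq[OF assms])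
  also have "\<dots> = card (\<Union>l\<in>{l\<in>ev ` B. P l}. {b\<in>B. ev b = l})"
    using finite_B by (intro card_UN_disjoint[symmetric]) auto
  also have "(\<Union>l\<in>{l\<in>ev ` B. P l}. {b\<in>B. ev b = l}) = {b\<in>B. P (ev b)}" by auto
  finally show ?thesis .
qed

lemma length_eigenvalue_list: "length (eigenvalue_list adj w \<mu>) = CARD('v)"
proof -
  obtain B ev where B: "orthonormal_eigenbasis symlap B ev" using eigenbasis_exists by blast
  have "card B = CARD('v)" using orthonormal_eigenbasis.card_B[OF B] by simp
  then show ?thesis using length_filter_eigenvalue_list[OF B, of "\<lambda>_. True"] by simp
qed

text \<open>Courant-Fischer in the form used below, with test spaces given by explicit orthogonal functions:
  two functions for the Poincare inequality, and \<open>k\<close> functions with disjoint supports for the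
  improved Cheeger inequality.\<close>

lemma eigenvalue_le_of_orthogonal_family:
  assumes k: "1 \<le> k" "k \<le> card I" and I: "finite I"
    and gorth: "\<And>i j. i \<in> I \<Longrightarrow> j \<in> I \<Longrightarrow> i \<noteq> j \<Longrightarrow> inprod (g i) (g j) = 0"
    and pos: "\<And>i. i \<in> I \<Longrightarrow> inprod (g i) (g i) > 0"
    and le: "\<And>c. energy (\<lambda>x. \<Sum>i\<in>I. c i * g i x) (\<lambda>x. \<Sum>i\<in>I. c i * g i x)
      \<le> C * (\<Sum>i\<in>I. (c i)\<^sup>2 * inprod (g i) (g i))"
  shows "eigenvalue adj w \<mu> k \<le> C"
proof -
  obtain B ev where "orthonormal_eigenbasis symlap B ev" using eigenbasis_exists by blast
  then interpret orthonormal_eigenbasis symlap B ev .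
  define v :: "_ \<Rightarrow> real ^ 'v" where "v i = (\<chi> x. g i x * sqrt (\<mu> x))" for i
  have uv: "unscale (v i) = (\<chi> x. g i x)" for i
    using \<mu>_pos by (auto simp: unscale_def v_def vec_eq_iff less_imp_neq[symmetric])
  have ip: "v i \<bullet> v j = inprod (g i) (g j)" for i j by (simp add: inner_unscale uv)
  have inj: "inj_on v I"
  proof (rule inj_onI, rule ccontr)
    fix i j assume "i \<in> I" "j \<in> I" "v i = v j" "i \<noteq> j"
    then show False using ip[of i j] ip[of i i] gorth[of i j] pos[of i] by simp
  qed
  have "pairwise orthogonal (v ` I)"
    unfolding pairwise_def orthogonal_def using ip gorth by auto
  moreover have "v i \<noteq> 0" if "i \<in> I" for i using ip[of i i] pos[OF that] by auto
  then have "0 \<notin> v ` I" by (metis imageE)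
  ultimately have "independent (v ` I)" by (rule pairwise_orthogonal_independent)
  then have "dim (span (v ` I)) = card (v ` I)" by (rule dim_span_eq_card_independent)
  then have dim: "dim (span (v ` I)) = card I" by (simp add: card_image[OF inj])
  have "symlap z \<bullet> z \<le> C * (z \<bullet> z)" if "z \<in> span (v ` I)" for z
  proof -
    have "z \<in> range (\<lambda>u. \<Sum>y\<in>v ` I. u y *\<^sub>R y)" using that span_finite[of "v ` I"] I by simp
    then obtain u where "z = (\<Sum>y\<in>v ` I. u y *\<^sub>R y)" by (rule rangeE)
    then have z: "z = (\<Sum>i\<in>I. u (v i) *\<^sub>R v i)" by (simp add: sum.reindex[OF inj])
    have uz: "unscale z $ x = (\<Sum>i\<in>I. u (v i) * g i x)" for x
      unfolding z linear_sum[OF linear_unscale] by (simp add: linear_scale[OF linear_unscale] uv)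
    have "z \<bullet> z = (\<Sum>i\<in>I. \<Sum>j\<in>I. u (v i) * u (v j) * (v i \<bullet> v j))"
      by (simp add: z inner_sum_left inner_sum_right sum_distrib_left algebra_simps)
        (simp add: inner_commute)
    also have "\<dots> = (\<Sum>i\<in>I. \<Sum>j\<in>I. if j = i then (u (v i))\<^sup>2 * inprod (g i) (g i) else 0)"
      by (intro sum.cong refl) (auto simp: ip gorth power2_eq_square)
    also have "\<dots> = (\<Sum>i\<in>I. (u (v i))\<^sup>2 * inprod (g i) (g i))" using I by simp
    finally show ?thesis using le[of "\<lambda>i. u (v i)"] by (simp add: symlap_inner uz)
  qed
  then have "card I \<le> card {b\<in>B. ev b \<le> C}"
    using dim_le_card_eigenvalues_le[where W = "span (v ` I)" and c = C] dim by simp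
  then have "k \<le> length (filter (\<lambda>l. l \<le> C) (eigenvalue_list adj w \<mu>))"
    using k length_filter_eigenvalue_list[OF orthonormal_eigenbasis_axioms] by simp
  then show ?thesis
    unfolding eigenvalue_def using sorted_nth_le_if_length_filter sorted_eigenvalue_list k by blast
qed

lemma eigenvalue_has_eigenfunction:
  assumes "1 \<le> k" "k \<le> CARD('v)"
  obtains f where "\<And>x. lap f x = - eigenvalue adj w \<mu> k * f x" "\<exists>x. f x \<noteq> 0"
proof -
  have "eigenvalue adj w \<mu> k \<in> set (eigenvalue_list adj w \<mu>)"
    unfolding eigenvalue_def using assms by (intro nth_mem) (simp add: length_eigenvalue_list)
  then have "eigenvalue adj w \<mu> k \<in> eigenvalues adj w \<mu>"
    using finite_eigenvalues by (auto simp: eigenvalue_list_def)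
  then obtain g where g: "g \<in> eigenspace adj w \<mu> (eigenvalue adj w \<mu> k)" "g \<noteq> 0"
    by (auto simp: eigenvalues_def)
  show thesis
  proof (rule that[of "\<lambda>x. g $ x"])
    show "lap (($) g) x = - eigenvalue adj w \<mu> k * g $ x" for x
      using g(1) by (simp add: eigenspace_def eq_neg_iff_add_eq_0)
    show "\<exists>x. g $ x \<noteq> 0" using g(2) by (simp add: vec_eq_iff)
  qed
qed

lemma eigenfunction_energy:
  assumes "\<And>x. lap f x = - l * f x"
  shows "energy f g = l * inprod f g"
  using inprod_lap[of f g] assms by (simp add: inprod_def sum_negf sum_distrib_left mult_ac)

text \<open>Connectedness makes \<open>0\<close> a simple eigenvalue, and hence the second eigenvalue positive.\<close>

lemma energy_zero_imp_constant:
  assumes "energy f f = 0" shows "f x = f y"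
proof -
  have "(\<Sum>x\<in>UNIV. \<Sum>y\<in>UNIV. w x y * ((f x - f y) * (f x - f y))) = 0"
    using assms by (simp add: energy_def)
  then have z: "w a b * ((f a - f b) * (f a - f b)) = 0" for a b
    using w_nonneg by (auto simp: sum_nonneg_eq_0_iff sum_nonneg)
  have step: "f a = f b" if "adj a b" for a b using that w_pos_iff[of a b] z[of a b] by auto
  show ?thesis using connected[of x y] by (induction rule: rtranclp_induct) (auto dest: step)
qed

lemma dim_eigenspace_0: "dim (eigenspace adj w \<mu> 0) \<le> 1"
proof -
  have "eigenspace adj w \<mu> 0 \<subseteq> span {\<chi> x. (1 :: real)}"
  proof
    fix f assume "f \<in> eigenspace adj w \<mu> 0"
    then have "energy (($) f) (($) f) = 0"
      using eigenfunction_energy[of "($) f" 0 "($) f"] by (simp add: eigenspace_def)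
    then have "f $ x = f $ y" for x y by (rule energy_zero_imp_constant)
    then have "f = (f $ (SOME x. True)) *\<^sub>R (\<chi> x. (1 :: real))" by (simp add: vec_eq_iff)
    then show "f \<in> span {\<chi> x. (1 :: real)}" by (metis span_base span_scale singletonI)
  qed
  then have "dim (eigenspace adj w \<mu> 0) \<le> dim {\<chi> x::'v. (1::real)}" using dim_mono by blast
  also have "\<dots> \<le> 1" using dim_le_card'[of "{\<chi> x::'v. (1::real)}"] by simp
  finally show ?thesis .
qed

lemma eigenvalue_mono:
  assumes "1 \<le> i" "i \<le> k" "k \<le> CARD('v)"
  shows "eigenvalue adj w \<mu> i \<le> eigenvalue adj w \<mu> k"
  unfolding eigenvalue_def using assms
  by (intro sorted_nth_mono[OF sorted_eigenvalue_list]) (auto simp: length_eigenvalue_list)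

lemma eigenvalue_nonneg:
  assumes "1 \<le> k" "k \<le> CARD('v)" shows "eigenvalue adj w \<mu> k \<ge> 0"
proof -
  obtain f x where f: "\<And>x. lap f x = - eigenvalue adj w \<mu> k * f x" "f x \<noteq> 0"
    using eigenvalue_has_eigenfunction[OF assms] by metis
  have "eigenvalue adj w \<mu> k * inprod f f \<ge> 0"
    using eigenfunction_energy[OF f(1), of f] energy_nonneg[of f] by simp
  then show ?thesis using inprod_pos[of f, OF f(2)] by (simp add: zero_le_mult_iff)
qed

lemma eigenvalue_2_pos:
  assumes "2 \<le> CARD('v)" shows "eigenvalue adj w \<mu> 2 > 0"
proof (rule ccontr)
  assume "\<not> eigenvalue adj w \<mu> 2 > 0"
  moreover have "eigenvalue adj w \<mu> 1 \<ge> 0" "eigenvalue adj w \<mu> 1 \<le> eigenvalue adj w \<mu> 2"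
    using assms eigenvalue_nonneg eigenvalue_mono by auto
  ultimately have "eigenvalue adj w \<mu> 1 = 0" "eigenvalue adj w \<mu> 2 = 0" by auto
  then have "{0, 1} \<subseteq> {i. i < length (eigenvalue_list adj w \<mu>) \<and> eigenvalue_list adj w \<mu> ! i = 0}"
    using assms by (auto simp: length_eigenvalue_list eigenvalue_def)
  then have "2 \<le> length (filter (\<lambda>l. l = 0) (eigenvalue_list adj w \<mu>))"
    unfolding length_filter_conv_card
    using card_mono[of "{i. i < length (eigenvalue_list adj w \<mu>) \<and> eigenvalue_list adj w \<mu> ! i = 0}" "{0, 1}"]
    by simp
  also have "\<dots> = (\<Sum>l\<in>{l\<in>eigenvalues adj w \<mu>. l = 0}. dim (eigenspace adj w \<mu> l))"
    unfolding eigenvalue_list_def by (rule length_filter_concat_replicate[OF finite_eigenvalues])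
  also have "\<dots> \<le> (\<Sum>l\<in>{0}. dim (eigenspace adj w \<mu> l))"
    by (intro sum_mono2) auto
  finally show False using dim_eigenspace_0 by simp
qed

text \<open>The test space is spanned by the constants and \<open>g\<close>. Constants carry no energy and are
  orthogonal to \<open>g\<close>, so no function in it has a larger Rayleigh quotient than \<open>g\<close>.\<close>

lemma poincare:
  assumes mean: "inprod (\<lambda>_. 1) g = 0"
  shows "eigenvalue adj w \<mu> 2 * inprod g g \<le> energy g g"
proof (cases "\<exists>x. g x \<noteq> 0")
  case False
  then show ?thesis by (simp add: inprod_def energy_def)
next
  case True
  then have pos: "inprod g g > 0" using inprod_pos by blast
  define h where "h i = (if i = 0 then (\<lambda>_. 1) else g)" for i :: nat
  have "eigenvalue adj w \<mu> 2 \<le> energy g g / inprod g g"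
  proof (rule eigenvalue_le_of_orthogonal_family[where I = "{0, 1}" and g = h])
    show "inprod (h i) (h j) = 0" if "i \<in> {0, 1}" "j \<in> {0, 1}" "i \<noteq> j" for i j
      using that mean by (auto simp: h_def inprod_sym)
    show "inprod (h i) (h i) > 0" if "i \<in> {0, 1}" for i
      using that pos inprod_pos[of "\<lambda>_. 1"] by (auto simp: h_def)
    fix c :: "nat \<Rightarrow> real"
    have "energy (\<lambda>x. \<Sum>i\<in>{0, 1}. c i * h i x) (\<lambda>x. \<Sum>i\<in>{0, 1}. c i * h i x)
        = (c 1)\<^sup>2 * energy g g"
      by (simp add: energy_def h_def sum_distrib_left power2_eq_square algebra_simps sum_divide_distrib)
    also have "\<dots> = energy g g / inprod g g * ((c 1)\<^sup>2 * inprod g g)" using pos by simp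
    also have "\<dots> \<le> energy g g / inprod g g * (\<Sum>i\<in>{0, 1}. (c i)\<^sup>2 * inprod (h i) (h i))"
      using pos energy_nonneg inprod_nonneg[of "h 0"]
      by (intro mult_left_mono) (auto simp: h_def)
    finally show "energy (\<lambda>x. \<Sum>i\<in>{0, 1}. c i * h i x) (\<lambda>x. \<Sum>i\<in>{0, 1}. c i * h i x)
        \<le> energy g g / inprod g g * (\<Sum>i\<in>{0, 1}. (c i)\<^sup>2 * inprod (h i) (h i))" .
  qed auto
  then show ?thesis using pos by (simp add: field_simps)
qed

end

section \<open>Implicit Euler steps\<close>

context connected_weighted_graph
begin

abbreviation \<Gamma> :: "('v \<Rightarrow> real) \<Rightarrow> 'v \<Rightarrow> real" where "\<Gamma> f \<equiv> gamma lap f f"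

lemma gamma_eq: "gamma lap f g x = (\<Sum>y\<in>UNIV. w x y * ((f y - f x) * (g y - g x))) / (2 * \<mu> x)"
proof -
  have "(\<Sum>y\<in>UNIV. w x y * ((f y - f x) * (g y - g x)))
      = (\<Sum>y\<in>UNIV. w x y * (f y * g y - f x * g x)) - f x * (\<Sum>y\<in>UNIV. w x y * (g y - g x))
        - g x * (\<Sum>y\<in>UNIV. w x y * (f y - f x))"
    unfolding sum_distrib_left sum_subtractf[symmetric]
    by (intro sum.cong refl) (simp add: algebra_simps)
  then show ?thesis unfolding gamma_def lap_eq by (simp only:) (simp add: diff_divide_distrib)
qed

lemma gamma_nonneg: "\<Gamma> f x \<ge> 0"
  unfolding gamma_eq using w_nonneg \<mu>_pos[of x] by (simp add: sum_nonneg)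

lemma gamma_diff_scale: "\<Gamma> (\<lambda>y. f y - c * g y) x = \<Gamma> f x - 2 * c * gamma lap f g x + c\<^sup>2 * \<Gamma> g x"
proof -
  have "(\<Sum>y\<in>UNIV. w x y * ((f y - c * g y - (f x - c * g x)) * (f y - c * g y - (f x - c * g x))))
      = (\<Sum>y\<in>UNIV. w x y * ((f y - f x) * (f y - f x)))
        - 2 * c * (\<Sum>y\<in>UNIV. w x y * ((f y - f x) * (g y - g x)))
        + c\<^sup>2 * (\<Sum>y\<in>UNIV. w x y * ((g y - g x) * (g y - g x)))"
    unfolding sum_distrib_left sum_subtractf[symmetric] sum.distrib[symmetric]
    by (intro sum.cong refl) (simp add: algebra_simps power2_eq_square)
  then show ?thesis by (simp add: gamma_eq add_divide_distrib diff_divide_distrib)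
qed

text \<open>The chain rule; the nonnegative term \<open>\<Gamma> f\<close> is the source of all regularisation below.\<close>

lemma lap_square: "lap (\<lambda>y. (f y)\<^sup>2) x = 2 * \<Gamma> f x + 2 * f x * lap f x"
  by (simp add: gamma_def power2_eq_square diff_divide_distrib)

text \<open>At a vertex where \<open>F\<close> is largest, \<open>lap F\<close> is at most \<open>0\<close>. Equivalently, the inverse of
  \<open>1 - \<tau> lap\<close> preserves upper bounds.\<close>

lemma maximum_principle:
  assumes "\<tau> \<ge> 0" and le: "\<And>x. F x - \<tau> * lap F x \<le> M"
  shows "F x \<le> M"
proof -
  obtain z where z: "\<And>y. F y \<le> F z"
  proof -
    have "Max (range F) \<in> range F" by (intro Max_in) auto
    then obtain z where z: "F z = Max (range F)" by (metis imageE)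
    have "F y \<le> F z" for y unfolding z by (intro Max_ge) auto
    then show thesis by (rule that)
  qed
  have "lap F z \<le> 0"
    unfolding lap_eq using z \<mu>_pos[of z] w_nonneg
    by (intro divide_nonpos_pos sum_nonpos mult_nonneg_nonpos) auto
  then have "F z \<le> F z - \<tau> * lap F z" using assms(1) by (simp add: mult_nonneg_nonpos)
  then show ?thesis using le[of z] z[of x] by linarith
qed

lemma implicit_euler_step_exists:
  assumes "\<tau> \<ge> 0"
  shows "\<exists>u. \<forall>x. u x - \<tau> * lap u x = g x"
proof -
  define A :: "real ^ 'v \<Rightarrow> real ^ 'v" where "A u = (\<chi> x. u $ x - \<tau> * lap (($) u) x)" for u
  have lin: "linear A"
  proof (rule linearI)
    fix u v c
    show "A (u + v) = A u + A v"
    proof -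
      have "($) (u + v) = (\<lambda>y. u $ y + v $ y)" by auto
      then show ?thesis by (simp add: A_def vec_eq_iff lap_add algebra_simps)
    qed
    show "A (c *\<^sub>R u) = c *\<^sub>R A u"
    proof -
      have "($) (c *\<^sub>R u) = (\<lambda>y. c * u $ y)" by auto
      then show ?thesis by (simp add: A_def vec_eq_iff lap_scale algebra_simps)
    qed
  qed
  have le0: "u $ x \<le> 0" if "A u = 0" for u x
  proof (rule maximum_principle[OF assms])
    have "A u $ y = 0" for y using that by simp
    then show "u $ y - \<tau> * lap (($) u) y \<le> 0" for y unfolding A_def by simp
  qed
  have "u = 0" if "A u = 0" for u
  proof -
    have "A (- u) = 0" using that linear_neg[OF lin] by simp
    then show ?thesis using le0[OF that] le0[of "- u"] by (simp add: vec_eq_iff order_antisym)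
  qed
  then have "inj A" using linear_injective_0[OF lin] by blast
  with lin have "surj A" by (rule linear_injective_imp_surjective) (rule refl)
  then obtain u where "(\<chi> x. g x) = A u" by (metis surj_def)
  then have "\<forall>x. u $ x - \<tau> * lap (($) u) x = g x" by (simp add: A_def vec_eq_iff)
  then show ?thesis by blast
qed

text \<open>The implicit Euler scheme for the heat equation with time step \<open>\<tau>\<close>. It replaces the heat
  semigroup: each step inverts one linear map, and the gradient bound for the semigroup has a
  counterpart that needs only the maximum principle.\<close>

definition euler_sequence :: "real \<Rightarrow> (nat \<Rightarrow> 'v \<Rightarrow> real) \<Rightarrow> bool" where
  "euler_sequence \<tau> u \<longleftrightarrow> (\<forall>j x. u (Suc j) x - \<tau> * lap (u (Suc j)) x = u j x)"

lemma euler_sequence_exists: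
  assumes "\<tau> \<ge> 0" obtains u where "euler_sequence \<tau> u" "u 0 = f"
proof -
  obtain R where R: "\<And>g x. R g x - \<tau> * lap (R g) x = g x"
    using implicit_euler_step_exists[OF assms] by metis
  show thesis
    by (rule that[of "\<lambda>j. (R ^^ j) f"]) (simp_all add: euler_sequence_def R)
qed

text \<open>The discrete counterpart of the reverse Poincare inequality
  \<open>2 t \<Gamma>(P\<^sub>t f) \<le> P\<^sub>t(f\<^sup>2) - (P\<^sub>t f)\<^sup>2\<close>. Applying \<open>1 - \<tau> lap\<close> to the square of the
  solution gains the term \<open>- 2 \<tau> \<Gamma>\<close>, and nonnegative curvature says that \<open>\<Gamma>\<close> itself is a
  subsolution. So \<open>\<Gamma>\<close> may enter with a weight that grows by \<open>2 \<tau>\<close> in every step while the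
  maximum of the weighted sum still decreases. Evaluating \<open>\<Gamma>\<close> one step later than the square
  makes the two effects match.\<close>

lemma euler_sequence_gradient_bound:
  assumes CD: "CD_0_infinity adj w \<mu>" and \<tau>: "\<tau> \<ge> 0"
    and u: "euler_sequence \<tau> u" and K: "\<And>x. (u 0 x)\<^sup>2 \<le> K"
  shows "(u j x)\<^sup>2 + 2 * \<tau> * real j * \<Gamma> (u (Suc j)) x \<le> K"
proof (induction j arbitrary: x)
  case 0 then show ?case using K by simp
next
  case (Suc j)
  define v where "v = u (Suc j)"
  define z where "z = u (Suc (Suc j))"
  have v: "u j = (\<lambda>x. v x - \<tau> * lap v x)" and z: "v = (\<lambda>x. z x - \<tau> * lap z x)"
    using u unfolding euler_sequence_def v_def z_def by auto
  have square: "(v x)\<^sup>2 - \<tau> * lap (\<lambda>x. (v x)\<^sup>2) x \<le> (u j x)\<^sup>2 - 2 * \<tau> * \<Gamma> v x" for x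
  proof -
    have "(u j x)\<^sup>2 - 2 * \<tau> * \<Gamma> v x - ((v x)\<^sup>2 - \<tau> * lap (\<lambda>x. (v x)\<^sup>2) x) = (\<tau> * lap v x)\<^sup>2"
      unfolding v lap_square by (simp add: power2_eq_square algebra_simps)
    then show ?thesis by (metis diff_ge_0_iff_ge zero_le_power2)
  qed
  have grad: "\<Gamma> z x - \<tau> * lap (\<Gamma> z) x \<le> \<Gamma> v x" for x
  proof -
    have "0 \<le> gamma2 lap z z x" using CD by (simp add: CD_0_infinity_def)
    then have "2 * gamma lap z (lap z) x \<le> lap (\<Gamma> z) x" by (simp add: gamma2_def)
    then have "\<tau> * (2 * gamma lap z (lap z) x) \<le> \<tau> * lap (\<Gamma> z) x" using \<tau> by (rule mult_left_mono)
    moreover have "\<Gamma> v x = \<Gamma> z x - 2 * \<tau> * gamma lap z (lap z) x + \<tau>\<^sup>2 * \<Gamma> (lap z) x"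
      unfolding z using gamma_diff_scale by simp
    moreover have "\<tau>\<^sup>2 * \<Gamma> (lap z) x \<ge> 0" using gamma_nonneg by simp
    ultimately show ?thesis by linarith
  qed
  define c where "c = 2 * \<tau> * real (Suc j)"
  have c: "c \<ge> 0" unfolding c_def using \<tau> by simp
  define F where "F x = (v x)\<^sup>2 + c * \<Gamma> z x" for x
  have "F x - \<tau> * lap F x \<le> K" for x
  proof -
    have "F x - \<tau> * lap F x
        = (v x)\<^sup>2 - \<tau> * lap (\<lambda>x. (v x)\<^sup>2) x + c * (\<Gamma> z x - \<tau> * lap (\<Gamma> z) x)"
      unfolding F_def lap_add lap_scale by (simp add: algebra_simps)
    also have "\<dots> \<le> (u j x)\<^sup>2 - 2 * \<tau> * \<Gamma> v x + c * \<Gamma> v x"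
      by (intro add_mono square mult_left_mono grad c)
    also have "\<dots> = (u j x)\<^sup>2 + 2 * \<tau> * real j * \<Gamma> (u (Suc j)) x"
      unfolding c_def v_def by (simp add: algebra_simps)
    finally show ?thesis using Suc.IH[of x] by linarith
  qed
  then have "F x \<le> K" by (rule maximum_principle[OF \<tau>])
  then show ?case unfolding F_def c_def v_def z_def .
qed

lemma D_nor_bound: "0 < w x y \<Longrightarrow> \<mu> x \<le> D_nor adj w \<mu> * w x y"
proof -
  assume w: "0 < w x y"
  then have "adj y x" using w_pos_iff w_sym by metis
  then have "\<mu> x / w x y \<le> (MAX y\<in>{y. adj y x}. \<mu> x / w x y)" by (intro Max_ge) auto
  also have "\<dots> \<le> D_nor adj w \<mu>" unfolding D_nor_def by (intro Max_ge) auto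
  finally show ?thesis using w by (simp add: field_simps)
qed

lemma edge_exists:
  assumes "2 \<le> CARD('v)" obtains x y where "0 < w x y"
proof -
  have "\<not> is_singleton (UNIV :: 'v set)"
    using assms by (auto simp: is_singleton_altdef)
  then obtain x y :: 'v where "x \<noteq> y" by (metis UNIV_I is_singletonI' empty_not_UNIV)
  then have "\<exists>z. adj x z" using connected[of x y] by (auto elim: converse_rtranclpE)
  then show thesis using that w_pos_iff by blast
qed

lemma D_nor_pos:
  assumes "2 \<le> CARD('v)" shows "0 < D_nor adj w \<mu>"
proof -
  obtain x y where xy: "0 < w x y" using edge_exists[OF assms] by blast
  then have "0 < D_nor adj w \<mu> * w x y" using D_nor_bound[OF xy] \<mu>_pos[of x] by linarith
  then show ?thesis using xy by (simp add: zero_less_mult_iff)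
qed

text \<open>Each edge alone is bounded by the whole sum in \<open>\<Gamma>\<close>; \<open>D_nor\<close> is what this costs.\<close>

lemma jump_le_gamma:
  assumes "0 < w x y" shows "(f x - f y)\<^sup>2 \<le> 2 * D_nor adj w \<mu> * \<Gamma> f x"
proof -
  have "w x y * (f x - f y)\<^sup>2 = w x y * ((f y - f x) * (f y - f x))"
    by (simp add: power2_eq_square algebra_simps)
  also have "\<dots> \<le> (\<Sum>y\<in>UNIV. w x y * ((f y - f x) * (f y - f x)))"
    using w_nonneg by (intro member_le_sum) auto
  also have "\<dots> = 2 * \<mu> x * \<Gamma> f x" using \<mu>_pos[of x] by (simp add: gamma_eq)
  also have "\<dots> \<le> 2 * (D_nor adj w \<mu> * w x y) * \<Gamma> f x"
    using D_nor_bound[OF assms] gamma_nonneg by (intro mult_right_mono) auto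
  finally have "w x y * (f x - f y)\<^sup>2 \<le> w x y * (2 * D_nor adj w \<mu> * \<Gamma> f x)"
    by (simp add: mult_ac)
  then show ?thesis using assms by simp
qed

section \<open>Buser's isoperimetric inequality\<close>

text \<open>The total variation; on the indicator of \<open>A\<close> it is the weight of the edge boundary of \<open>A\<close>.\<close>

definition tv :: "('v \<Rightarrow> real) \<Rightarrow> real" where
  "tv f = (\<Sum>x\<in>UNIV. \<Sum>y\<in>UNIV. w x y * \<bar>f x - f y\<bar>) / 2"

lemma tv_nonneg: "tv f \<ge> 0"
  unfolding tv_def using w_nonneg by (auto intro!: sum_nonneg)

lemma energy_le_tv:
  assumes "\<And>x y. 0 < w x y \<Longrightarrow> \<bar>u x - u y\<bar> \<le> J"
  shows "energy u g \<le> J * tv g"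
proof -
  have "w x y * ((u x - u y) * (g x - g y)) \<le> J * (w x y * \<bar>g x - g y\<bar>)" for x y
  proof (cases "0 < w x y")
    case True
    have "(u x - u y) * (g x - g y) \<le> \<bar>u x - u y\<bar> * \<bar>g x - g y\<bar>"
      by (metis abs_ge_self abs_mult)
    also have "\<dots> \<le> J * \<bar>g x - g y\<bar>" using assms[OF True] by (intro mult_right_mono) auto
    finally show ?thesis using True by (simp add: mult.left_commute[of J])
  next
    case False
    then have "w x y = 0" using w_nonneg[of x y] by simp
    then show ?thesis by simp
  qed
  then have "(\<Sum>x\<in>UNIV. \<Sum>y\<in>UNIV. w x y * ((u x - u y) * (g x - g y)))
      \<le> (\<Sum>x\<in>UNIV. \<Sum>y\<in>UNIV. J * (w x y * \<bar>g x - g y\<bar>))"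
    by (intro sum_mono)
  then show ?thesis by (simp add: energy_def tv_def sum_distrib_left[symmetric])
qed

lemma inprod_diff_left: "inprod (\<lambda>x. f x - g x) h = inprod f h - inprod g h"
  by (simp add: inprod_def sum_subtractf algebra_simps)

lemma inprod_diff_right: "inprod h (\<lambda>x. f x - g x) = inprod h f - inprod h g"
  by (simp add: inprod_def sum_subtractf algebra_simps)

lemma inprod_scale_left: "inprod (\<lambda>x. c * f x) h = c * inprod f h"
  by (simp add: inprod_def sum_distrib_left mult_ac)

lemma inprod_amgm:
  assumes "s > 0" shows "2 * inprod f g \<le> s * inprod f f + inprod g g / s"
proof -
  have "0 \<le> inprod (\<lambda>x. s * f x - g x) (\<lambda>x. s * f x - g x)" by (rule inprod_nonneg)
  also have "\<dots> = s * (s * inprod f f) - 2 * s * inprod f g + inprod g g"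
    by (simp add: inprod_diff_left inprod_diff_right inprod_scale_left
      inprod_sym[of f "\<lambda>x. s * f x"] inprod_sym[of g "\<lambda>x. s * f x"] inprod_sym[of g f])
  finally have "s * (2 * inprod f g) \<le> s * (s * inprod f f + inprod g g / s)"
    using assms by (simp add: distrib_left)
  then show ?thesis using assms by simp
qed

lemma sum_inverse_sqrt: "(\<Sum>j<n. 1 / sqrt (real (Suc j))) \<le> 2 * sqrt (real n)"
proof (induction n)
  case (Suc n)
  define a b where "a = sqrt (real n)" and "b = sqrt (real (Suc n))"
  have ab: "0 \<le> a" "0 < b" "b\<^sup>2 = a\<^sup>2 + 1" unfolding a_def b_def by auto
  have "0 \<le> (b - a)\<^sup>2" by simp
  then have "2 * a * b + 1 \<le> 2 * b\<^sup>2" using ab by (simp add: power2_eq_square algebra_simps)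
  then have "2 * a + 1 / b \<le> 2 * b" using ab by (simp add: field_simps power2_eq_square)
  then show ?case using Suc unfolding a_def b_def by simp
qed simp

text \<open>After \<open>j + 1\<close> steps the solution jumps by at most a multiple of \<open>1 / \<surd>j\<close> along an edge. The first
  step, for which the gradient bound says nothing, contributes the summand \<open>1\<close> through the
  oscillation of the initial datum; it disappears when the time step tends to \<open>0\<close>.\<close>

lemma energy_of_euler_sequence_le:
  assumes CD: "CD_0_infinity adj w \<mu>" and card: "2 \<le> CARD('v)" and \<tau>: "\<tau> > 0"
    and u: "euler_sequence \<tau> u" and u0: "\<And>x. \<bar>u 0 x\<bar> \<le> 1 / 2"
  shows "(\<Sum>j<n. energy (u (Suc j)) g)
    \<le> (1 + sqrt (D_nor adj w \<mu> * real n / \<tau>)) * tv g"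
proof -
  have K: "(u j x)\<^sup>2 + 2 * \<tau> * real j * \<Gamma> (u (Suc j)) x \<le> 1 / 4" for j x
  proof (rule euler_sequence_gradient_bound[OF CD _ u])
    show "(u 0 x)\<^sup>2 \<le> 1 / 4" for x
      using power_mono[OF u0[of x], of 2] by (simp add: power_divide)
  qed (use \<tau> in simp)
  have first: "energy (u (Suc 0)) g \<le> 1 * tv g"
  proof (rule energy_le_tv)
    fix x y
    have "(u (Suc 0) z)\<^sup>2 \<le> (1 / 2)\<^sup>2" for z
    proof -
      have "0 \<le> 2 * \<tau> * real (Suc 0) * \<Gamma> (u (Suc (Suc 0))) z"
        using \<tau> gamma_nonneg by (intro mult_nonneg_nonneg) auto
      then show ?thesis using K[of "Suc 0" z] by (simp add: power_divide)
    qed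
    then have "\<bar>u (Suc 0) z\<bar> \<le> 1 / 2" for z using abs_le_square_iff[of "u (Suc 0) z" "1 / 2"] by simp
    from this[of x] this[of y] show "\<bar>u (Suc 0) x - u (Suc 0) y\<bar> \<le> 1" by linarith
  qed
  define D where "D = D_nor adj w \<mu>"
  have D: "D > 0" unfolding D_def using D_nor_pos[OF card] .
  define d where "d = sqrt (D / \<tau>) / 2"
  have d: "d \<ge> 0" "d\<^sup>2 = D / (4 * \<tau>)" unfolding d_def using D \<tau> by (auto simp: power_divide)
  have later: "energy (u (Suc (Suc j))) g \<le> d / sqrt (real (Suc j)) * tv g" for j
  proof (rule energy_le_tv)
    fix x y assume xy: "0 < w x y"
    let ?v = "u (Suc (Suc j))"
    have "2 * \<tau> * real (Suc j) * \<Gamma> ?v x \<le> 1 / 4"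
      using K[of "Suc j" x] zero_le_power2[of "u (Suc j) x"] by linarith
    then have g: "\<Gamma> ?v x \<le> 1 / (8 * \<tau> * real (Suc j))" 
    proof -
      have "\<Gamma> ?v x * (8 * \<tau> * real (Suc j)) \<le> 1"
        using \<open>2 * \<tau> * real (Suc j) * \<Gamma> ?v x \<le> 1 / 4\<close> by (simp only: mult_ac)
      moreover have "0 < 8 * \<tau> * real (Suc j)" using \<tau> by simp
      ultimately show ?thesis by (simp only: pos_le_divide_eq)
    qed
    have "(?v x - ?v y)\<^sup>2 \<le> 2 * D * \<Gamma> ?v x" using jump_le_gamma[OF xy] by (simp add: D_def)
    also have "\<dots> \<le> 2 * D * (1 / (8 * \<tau> * real (Suc j)))" using g D by (intro mult_left_mono) auto
    also have "\<dots> = (d / sqrt (real (Suc j)))\<^sup>2" by (simp add: power_divide d(2) del: of_nat_Suc)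
    finally show "\<bar>?v x - ?v y\<bar> \<le> d / sqrt (real (Suc j))"
      using d by (simp only: abs_le_square_iff[symmetric]) simp
  qed
  show ?thesis
  proof (cases n)
    case 0 then show ?thesis using tv_nonneg by simp
  next
    case (Suc m)
    have "(\<Sum>j<n. energy (u (Suc j)) g) = energy (u (Suc 0)) g + (\<Sum>j<m. energy (u (Suc (Suc j))) g)"
      unfolding Suc by (rule sum.lessThan_Suc_shift)
    also have "\<dots> \<le> 1 * tv g + (\<Sum>j<m. d / sqrt (real (Suc j)) * tv g)"
      by (intro add_mono first sum_mono later)
    also have "\<dots> = (1 + d * (\<Sum>j<m. 1 / sqrt (real (Suc j)))) * tv g"
      by (simp add: sum_distrib_left sum_distrib_right algebra_simps)
    also have "\<dots> \<le> (1 + d * (2 * sqrt (real m))) * tv g"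
      by (intro mult_right_mono add_left_mono mult_left_mono sum_inverse_sqrt d tv_nonneg)
    also have "\<dots> = (1 + sqrt (D * real m / \<tau>)) * tv g"
      by (simp add: d_def real_sqrt_mult real_sqrt_divide)
    also have "\<dots> \<le> (1 + sqrt (D * real n / \<tau>)) * tv g"
      using D \<tau> Suc tv_nonneg
      by (intro mult_right_mono add_left_mono real_sqrt_le_mono divide_right_mono mult_left_mono) auto
    finally show ?thesis unfolding D_def .
  qed
qed

lemma euler_sequence_mean:
  assumes "euler_sequence \<tau> u"
  shows "inprod (u j) (\<lambda>_. 1) = inprod (u 0) (\<lambda>_. 1)"
proof (induction j)
  case (Suc j)
  have "u j = (\<lambda>x. u (Suc j) x - \<tau> * lap (u (Suc j)) x)"
    using assms by (auto simp: euler_sequence_def)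
  then have "inprod (u j) (\<lambda>_. 1) = inprod (u (Suc j)) (\<lambda>_. 1) + \<tau> * energy (u (Suc j)) (\<lambda>_. 1)"
    by (simp add: inprod_diff_left inprod_scale_left inprod_lap)
  then show ?case using Suc by (simp add: energy_def)
qed simp

text \<open>One step multiplies the norm by at most \<open>1 / q\<close>, by the Poincare inequality. The pairing with the
  initial datum is then estimated by the arithmetic-geometric mean inequality, weighted by powers of
  \<open>q\<close> so that no square roots of norms appear.\<close>

lemma euler_sequence_decay:
  assumes card: "2 \<le> CARD('v)" and \<tau>: "\<tau> \<ge> 0" and u: "euler_sequence \<tau> u"
    and mean: "inprod (u 0) (\<lambda>_. 1) = 0"
  defines "q \<equiv> 1 + \<tau> * eigenvalue adj w \<mu> 2"
  shows "inprod (u n) (u 0) \<le> inprod (u 0) (u 0) / q ^ n"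
proof -
  have q: "q > 0" unfolding q_def using \<tau> eigenvalue_2_pos[OF card] by (intro add_pos_nonneg) auto
  have step: "q\<^sup>2 * inprod (u (Suc j)) (u (Suc j)) \<le> inprod (u j) (u j)" for j
  proof -
    let ?v = "u (Suc j)"
    have "inprod (\<lambda>_. 1) ?v = 0" using euler_sequence_mean[OF u, of "Suc j"] mean by (simp add: inprod_sym)
    then have "\<tau> * (eigenvalue adj w \<mu> 2 * inprod ?v ?v) \<le> \<tau> * energy ?v ?v"
      using \<tau> by (intro mult_left_mono poincare)
    moreover have "u j = (\<lambda>x. ?v x - \<tau> * lap ?v x)" using u by (auto simp: euler_sequence_def)
    then have "inprod (u j) ?v = inprod ?v ?v + \<tau> * energy ?v ?v"
      by (simp add: inprod_diff_left inprod_scale_left inprod_lap)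
    ultimately have "q * inprod ?v ?v \<le> inprod (u j) ?v" unfolding q_def by (simp add: algebra_simps)
    moreover have "2 * inprod (u j) ?v \<le> (1 / q) * inprod (u j) (u j) + inprod ?v ?v / (1 / q)"
      using q by (intro inprod_amgm) simp
    ultimately have "q * inprod ?v ?v \<le> inprod (u j) (u j) / q" by (simp add: mult.commute)
    then show ?thesis using q by (simp add: field_simps power2_eq_square)
  qed
  have "q ^ n * q ^ n * inprod (u n) (u n) \<le> inprod (u 0) (u 0)"
  proof (induction n)
    case (Suc n)
    have "q ^ Suc n * q ^ Suc n * inprod (u (Suc n)) (u (Suc n))
        = q ^ n * q ^ n * (q\<^sup>2 * inprod (u (Suc n)) (u (Suc n)))"
      by (simp add: power2_eq_square mult_ac)
    also have "\<dots> \<le> q ^ n * q ^ n * inprod (u n) (u n)"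
      using q by (intro mult_left_mono step) auto
    finally show ?case using Suc by linarith
  qed simp
  then have "q ^ n * inprod (u n) (u n) \<le> inprod (u 0) (u 0) / q ^ n"
    using q by (simp add: field_simps)
  moreover have "2 * inprod (u n) (u 0) \<le> q ^ n * inprod (u n) (u n) + inprod (u 0) (u 0) / q ^ n"
    using q by (intro inprod_amgm) simp
  ultimately show ?thesis by linarith
qed

text \<open>Let the indicator of \<open>A\<close> evolve up to the time \<open>1 / \<lambda>\<^sub>2\<close> in \<open>n\<close> steps. The spectral gap forces
  a definite part of its mass to leave \<open>A\<close>, while all of that mass has to cross the boundary of
  \<open>A\<close> at a rate limited by the gradient bound.\<close>

lemma buser_finite:
  assumes CD: "CD_0_infinity adj w \<mu>" and card: "2 \<le> CARD('v)"
    and half: "2 * sum \<mu> A \<le> sum \<mu> UNIV" and n: "n > 0"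
  defines "l \<equiv> eigenvalue adj w \<mu> 2"
  shows "sum \<mu> A / 2 * (1 - 1 / (1 + 1 / real n) ^ n)
    \<le> (1 / (l * real n) + sqrt (D_nor adj w \<mu> / l)) * tv (indicat_real A)"
proof -
  have l: "l > 0" unfolding l_def using eigenvalue_2_pos[OF card] .
  define \<tau> where "\<tau> = 1 / (l * real n)"
  have \<tau>: "\<tau> > 0" unfolding \<tau>_def using l n by simp
  let ?I = "indicat_real A"
  \<comment> \<open>The shift by \<open>1 / 2\<close> halves the sup norm of the initial datum, and hence the gradient bound.\<close>
  obtain u where u: "euler_sequence \<tau> u" and u0: "u 0 = (\<lambda>x. ?I x - 1 / 2)"
    using euler_sequence_exists[of \<tau>] \<tau> by (metis order_less_imp_le)
  define m where "m = sum \<mu> A / sum \<mu> UNIV - 1 / 2"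
  have tot: "sum \<mu> UNIV > 0" using \<mu>_pos by (intro sum_pos) auto
  \<comment> \<open>A second shift, by the mean, gives a sequence to which the decay estimate applies.\<close>
  define v where "v j x = u j x - m" for j x
  have v: "euler_sequence \<tau> v"
    using u by (simp add: euler_sequence_def v_def lap_eq)
  have v0: "v 0 = (\<lambda>x. ?I x - sum \<mu> A / sum \<mu> UNIV)" by (rule ext) (simp add: v_def u0 m_def)
  have I1: "inprod ?I (\<lambda>_. 1) = sum \<mu> A" "inprod ?I ?I = sum \<mu> A"
    by (simp_all add: inprod_def indicator_def sum.If_cases if_distrib cong: if_cong)
  have c1: "inprod (\<lambda>_. c) (\<lambda>_. 1) = c * sum \<mu> UNIV" for c
    by (simp add: inprod_def sum_distrib_left mult.commute)
  have mean: "inprod (v 0) (\<lambda>_. 1) = 0"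
    using tot by (simp add: v0 inprod_diff_left I1 c1)
  have const: "inprod f (\<lambda>_. c) = c * inprod f (\<lambda>_. 1)" for f c
    by (simp add: inprod_def sum_distrib_left mult_ac)
  have pair: "inprod (v j) (v 0) = inprod (v j) ?I" for j
    unfolding v0 using euler_sequence_mean[OF v, of j] mean
    by (simp add: inprod_diff_right const[of "v j" "sum \<mu> A / sum \<mu> UNIV"])
  have norm: "inprod (v 0) (v 0) \<ge> sum \<mu> A / 2"
  proof -
    have "inprod (v 0) (v 0) = sum \<mu> A - sum \<mu> A / sum \<mu> UNIV * sum \<mu> A"
      unfolding pair
      by (simp add: v0 inprod_diff_left I1 inprod_sym[of "\<lambda>_. sum \<mu> A / sum \<mu> UNIV" ?I]
        const[of ?I "sum \<mu> A / sum \<mu> UNIV"])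
    moreover have "sum \<mu> A / sum \<mu> UNIV * sum \<mu> A \<le> 1 / 2 * sum \<mu> A"
      using half tot \<mu>_pos by (intro mult_right_mono sum_nonneg) (auto simp: field_simps less_imp_le)
    ultimately show ?thesis by linarith
  qed
  have q: "1 + \<tau> * eigenvalue adj w \<mu> 2 = 1 + 1 / real n"
    using l by (simp add: \<tau>_def l_def)
  have "sum \<mu> A / 2 * (1 - 1 / (1 + 1 / real n) ^ n)
      \<le> inprod (v 0) (v 0) * (1 - 1 / (1 + 1 / real n) ^ n)"
  proof (intro mult_right_mono)
    have "1 \<le> (1 + 1 / real n) ^ n" by (intro one_le_power) simp
    then have "1 / (1 + 1 / real n) ^ n \<le> 1 / 1" by (intro divide_left_mono) (auto intro!: zero_less_power add_pos_nonneg)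
    then show "0 \<le> 1 - 1 / (1 + 1 / real n) ^ n" by simp
  qed (fact norm)
  also have "\<dots> \<le> inprod (v 0) (v 0) - inprod (v n) (v 0)"
    using euler_sequence_decay[OF card _ v mean, of n] \<tau> unfolding q by (simp add: algebra_simps)
  also have "\<dots> = inprod (v 0) ?I - inprod (v n) ?I" by (simp add: pair)
  also have "\<dots> = \<tau> * (\<Sum>j<n. energy (u (Suc j)) ?I)"
  proof (induction n)
    case (Suc n)
    have "v n = (\<lambda>x. v (Suc n) x - \<tau> * lap (v (Suc n)) x)"
      using v by (auto simp: euler_sequence_def)
    then have "inprod (v n) ?I = inprod (v (Suc n)) ?I + \<tau> * energy (v (Suc n)) ?I"
      by (simp add: inprod_diff_left inprod_scale_left inprod_lap)
    moreover have "energy (v (Suc n)) ?I = energy (u (Suc n)) ?I" by (simp add: energy_def v_def)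
    ultimately show ?case using Suc by (simp add: algebra_simps)
  qed simp
  also have "\<dots> \<le> \<tau> * ((1 + sqrt (D_nor adj w \<mu> * real n / \<tau>)) * tv ?I)"
  proof (intro mult_left_mono energy_of_euler_sequence_le[OF CD card \<tau> u])
    show "\<bar>u 0 x\<bar> \<le> 1 / 2" for x by (simp add: u0 indicator_def)
  qed (use \<tau> in simp)
  also have "\<dots> = (1 / (l * real n) + sqrt (D_nor adj w \<mu> / l)) * tv ?I"
  proof -
    have "\<tau> * sqrt (D_nor adj w \<mu> * real n / \<tau>) = sqrt (\<tau>\<^sup>2 * (D_nor adj w \<mu> * real n / \<tau>))"
      using \<tau> by (simp only: real_sqrt_mult[of "\<tau>\<^sup>2"] real_sqrt_abs)
    also have "\<tau>\<^sup>2 * (D_nor adj w \<mu> * real n / \<tau>) = D_nor adj w \<mu> / l"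
      using l n by (simp add: \<tau>_def field_simps power2_eq_square)
    finally show ?thesis by (simp add: \<tau>_def algebra_simps)
  qed
  finally show ?thesis .
qed

text \<open>The limit of infinitely many steps, which turns \<open>(1 + 1 / n)\<^sup>n\<close> into \<open>e\<close>.\<close>

lemma buser:
  assumes CD: "CD_0_infinity adj w \<mu>" and card: "2 \<le> CARD('v)"
    and half: "2 * sum \<mu> A \<le> sum \<mu> UNIV"
  shows "(1 - exp (-1)) / 2 * sum \<mu> A
    \<le> sqrt (D_nor adj w \<mu> / eigenvalue adj w \<mu> 2) * tv (indicat_real A)"
proof -
  define l where "l = eigenvalue adj w \<mu> 2"
  have l: "l > 0" unfolding l_def using eigenvalue_2_pos[OF card] .
  have "(\<lambda>n. sum \<mu> A / 2 * (1 - 1 / (1 + 1 / real n) ^ n)) \<longlonglongrightarrow> sum \<mu> A / 2 * (1 - 1 / exp 1)"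
    by (intro tendsto_intros tendsto_exp_limit_sequentially) simp
  moreover have "(\<lambda>n. (1 / l * (1 / real n) + sqrt (D_nor adj w \<mu> / l)) * tv (indicat_real A))
      \<longlonglongrightarrow> (1 / l * 0 + sqrt (D_nor adj w \<mu> / l)) * tv (indicat_real A)"
    by (intro tendsto_intros lim_1_over_n)
  moreover have "\<exists>N. \<forall>n\<ge>N. sum \<mu> A / 2 * (1 - 1 / (1 + 1 / real n) ^ n)
      \<le> (1 / l * (1 / real n) + sqrt (D_nor adj w \<mu> / l)) * tv (indicat_real A)"
    using buser_finite[OF CD card half] unfolding l_def by (intro exI[of _ 1]) auto
  ultimately have "sum \<mu> A / 2 * (1 - 1 / exp 1)
      \<le> (1 / l * 0 + sqrt (D_nor adj w \<mu> / l)) * tv (indicat_real A)"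
    by (rule LIMSEQ_le)
  then show ?thesis by (simp add: l_def exp_minus field_simps)
qed

end

section \<open>Tent functions and thresholds\<close>

definition tent :: "real \<Rightarrow> real \<Rightarrow> real \<Rightarrow> real" where
  "tent a b s = max 0 (min (s - a) (b - s))"

text \<open>The projection of \<open>s\<close> to the interval from \<open>a\<close> to \<open>b\<close>. The projections to consecutive intervals
  split a displacement into disjoint pieces, which is how the tents over these intervals are
  controlled together.\<close>

definition clamp_to :: "real \<Rightarrow> real \<Rightarrow> real \<Rightarrow> real" where
  "clamp_to a b s = max a (min b s)"

definition half_ramp_square :: "real \<Rightarrow> real" where
  "half_ramp_square z = (max 0 z)\<^sup>2 / 2"

text \<open>A tent is a second difference of the ramp \<open>max 0\<close>, so its primitive is the same difference of
  \<open>half_ramp_square\<close>. In this form its derivative reduces to that of a single function.\<close>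

definition tent_primitive :: "real \<Rightarrow> real \<Rightarrow> real \<Rightarrow> real" where
  "tent_primitive a b s = half_ramp_square (s - a) - 2 * half_ramp_square (s - (a + b) / 2)
     + half_ramp_square (s - b)"

lemma half_ramp_square_deriv: "(half_ramp_square has_real_derivative max 0 z) (at z)"
proof -
  consider "z < 0" | "z > 0" | "z = 0" by linarith
  then show ?thesis
  proof cases
    case 1
    have "((\<lambda>_. 0) has_real_derivative max 0 z) (at z)" using 1 by simp
    then show ?thesis
      by (rule has_field_derivative_transform_within_open[of _ _ _ "{..<0}"])
        (use 1 in \<open>auto simp: half_ramp_square_def\<close>)
  next
    case 2
    have "((\<lambda>z. z\<^sup>2 / 2) has_real_derivative max 0 z) (at z)"
      using 2 by (auto intro!: derivative_eq_intros)
    then show ?thesis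
      by (rule has_field_derivative_transform_within_open[of _ _ _ "{0<..}"])
        (use 2 in \<open>auto simp: half_ramp_square_def\<close>)
  next
    case 3
    have "((\<lambda>y::real. max 0 y / 2) \<longlongrightarrow> max 0 0 / 2) (at 0)" by (intro tendsto_intros) simp
    then have lim: "((\<lambda>y::real. max 0 y / 2) \<longlongrightarrow> 0) (at 0)" by simp
    have eq: "max 0 y / 2 = (half_ramp_square y - half_ramp_square 0) / (y - 0)" if "y \<noteq> 0" for y
      using that by (simp add: half_ramp_square_def max_def power2_eq_square)
    have "((\<lambda>y. (half_ramp_square y - half_ramp_square 0) / (y - 0)) \<longlongrightarrow> 0) (at 0)"
      by (rule LIM_equal[THEN iffD1, OF _ lim]) (use eq in blast)
    then show ?thesis using 3 by (simp add: has_field_derivative_iff)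
  qed
qed

lemma tent_primitive_deriv:
  assumes "a \<le> b" shows "(tent_primitive a b has_real_derivative tent a b s) (at s)"
proof -
  have shift: "((\<lambda>s. half_ramp_square (s - c)) has_real_derivative max 0 (s - c)) (at s)" for c
    using DERIV_shift[of half_ramp_square "max 0 (s - c)" s "- c"] half_ramp_square_deriv by simp
  have "((\<lambda>s. half_ramp_square (s - a) - 2 * half_ramp_square (s - (a + b) / 2) + half_ramp_square (s - b))
      has_real_derivative max 0 (s - a) - 2 * max 0 (s - (a + b) / 2) + max 0 (s - b)) (at s)"
    by (intro DERIV_add DERIV_diff DERIV_cmult shift)
  moreover have "max 0 (s - a) - 2 * max 0 (s - (a + b) / 2) + max 0 (s - b) = tent a b s"
    using assms by (auto simp: tent_def max_def min_def field_simps)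
  ultimately show ?thesis unfolding tent_primitive_def[abs_def] by simp
qed

lemma tent_nonneg: "tent a b s \<ge> 0"
  by (simp add: tent_def)

lemma tent_primitive_ge:
  assumes "a \<le> b" shows "(clamp_to a b s - a)\<^sup>2 / 4 \<le> tent_primitive a b s"
proof -
  have mid: "a \<le> (a + b) / 2" "(a + b) / 2 \<le> b" using assms by (auto simp: field_simps)
  consider "s \<le> a" | "a \<le> s" "s \<le> (a + b) / 2" | "(a + b) / 2 \<le> s" "s \<le> b" | "b \<le> s" by linarith
  then show ?thesis
  proof cases
    case 1
    then show ?thesis using assms by (simp add: clamp_to_def tent_primitive_def half_ramp_square_def)
  next
    case 2
    then have eqs: "clamp_to a b s = s" "tent_primitive a b s = (s - a)\<^sup>2 / 2"
      using assms by (auto simp: clamp_to_def tent_primitive_def half_ramp_square_def max_def)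
    show ?thesis unfolding eqs using zero_le_power2[of "s - a"] by linarith
  next
    case 3
    with mid have "a \<le> s" by (meson order_trans)
    with 3 have "clamp_to a b s = s" "tent_primitive a b s = (s - a)\<^sup>2 / 2 - (s - (a + b) / 2)\<^sup>2"
      using assms 3 by (auto simp: clamp_to_def tent_primitive_def half_ramp_square_def max_def)
    moreover have "(s - (a + b) / 2)\<^sup>2 \<le> ((s - a) / 2)\<^sup>2" using 3 by (intro power_mono) (simp_all add: field_simps)
    ultimately show ?thesis by (simp add: power_divide)
  next
    case 4
    with assms mid have "a \<le> s" "(a + b) / 2 \<le> s" by (meson order_trans)+
    then have "clamp_to a b s = b"
      "tent_primitive a b s = (s - a)\<^sup>2 / 2 - (s - (a + b) / 2)\<^sup>2 + (s - b)\<^sup>2 / 2"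
      using assms 4 by (auto simp: clamp_to_def tent_primitive_def half_ramp_square_def max_def)
    then show ?thesis by (simp add: field_simps power2_eq_square)
  qed
qed

lemma tent_primitive_left: "a \<le> b \<Longrightarrow> s \<le> a \<Longrightarrow> tent_primitive a b s = 0"
  by (simp add: tent_primitive_def half_ramp_square_def)

lemma sum_clamp_to:
  assumes "mono t"
  shows "(\<Sum>i<N. clamp_to (t i) (t (Suc i)) s - t i) = clamp_to (t 0) (t N) s - t 0"
proof (induction N)
  case (Suc N)
  have "t 0 \<le> t N" "t N \<le> t (Suc N)" using assms by (simp_all add: monoD)
  then show ?case using Suc by (auto simp: clamp_to_def max_def min_def)
qed (simp add: clamp_to_def)

text \<open>A single tent is \<open>1\<close>-Lipschitz, and moving from \<open>s\<close> to \<open>s'\<close> changes the tent over an interval by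
  at most the distance travelled inside that interval. Hence even the sum over all tents grows at
  most like the total distance; this gives both the Lipschitz bound for the sum of the tents and the
  bound on the sum of their energies.\<close>

lemma sum_abs_tent_diff_le:
  assumes "mono t"
  shows "(\<Sum>i<N. \<bar>tent (t i) (t (Suc i)) s - tent (t i) (t (Suc i)) s'\<bar>) \<le> \<bar>s - s'\<bar>"
proof -
  have *: "(\<Sum>i<N. \<bar>tent (t i) (t (Suc i)) s - tent (t i) (t (Suc i)) s'\<bar>) \<le> s' - s" if "s \<le> s'" for s s'
  proof -
    have "\<bar>tent (t i) (t (Suc i)) s - tent (t i) (t (Suc i)) s'\<bar>
        \<le> (clamp_to (t i) (t (Suc i)) s' - t i) - (clamp_to (t i) (t (Suc i)) s - t i)" for i
      using that monoD[OF assms, of i "Suc i"] by (auto simp: tent_def clamp_to_def max_def min_def)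
    then have "(\<Sum>i<N. \<bar>tent (t i) (t (Suc i)) s - tent (t i) (t (Suc i)) s'\<bar>)
        \<le> (clamp_to (t 0) (t N) s' - t 0) - (clamp_to (t 0) (t N) s - t 0)"
      unfolding sum_clamp_to[OF assms, symmetric] sum_subtractf[symmetric] by (rule sum_mono)
    also have "\<dots> \<le> s' - s" using that monoD[OF assms, of 0 N] by (auto simp: clamp_to_def max_def min_def)
    finally show ?thesis .
  qed
  show ?thesis
  proof (cases "s \<le> s'")
    case True then show ?thesis using *[OF True] by simp
  next
    case False
    then have "s' \<le> s" by simp
    from *[OF this] show ?thesis using False by (simp add: abs_minus_commute)
  qed
qed

lemma tent_disjoint:
  assumes "mono t" "i \<noteq> j"
  shows "tent (t i) (t (Suc i)) s * tent (t j) (t (Suc j)) s = 0"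
proof -
  have *: "tent (t i) (t (Suc i)) s * tent (t j) (t (Suc j)) s = 0" if "i < j" for i j
    using monoD[OF assms(1), of "Suc i" j] that by (auto simp: tent_def max_def min_def)
  show ?thesis using *[of i j] *[of j i] assms(2) by (cases "i < j") (auto simp: mult.commute)
qed

text \<open>For increasing thresholds and \<open>s\<close> between \<open>t 0\<close> and \<open>t N\<close>, this is the distance of \<open>s\<close> to
  the nearest of \<open>t 0\<close>, ..., \<open>t N\<close>.\<close>

definition tents :: "(nat \<Rightarrow> real) \<Rightarrow> nat \<Rightarrow> real \<Rightarrow> real" where
  "tents t N s = (\<Sum>i<N. tent (t i) (t (Suc i)) s)"

definition tents_primitive :: "(nat \<Rightarrow> real) \<Rightarrow> nat \<Rightarrow> real \<Rightarrow> real" where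
  "tents_primitive t N s = (\<Sum>i<N. tent_primitive (t i) (t (Suc i)) s)"

lemma tents_nonneg: "tents t N s \<ge> 0"
  by (simp add: tents_def sum_nonneg tent_nonneg)

lemma tents_lipschitz:
  assumes "mono t" shows "\<bar>tents t N s - tents t N s'\<bar> \<le> \<bar>s - s'\<bar>"
proof -
  have "\<bar>tents t N s - tents t N s'\<bar> \<le> (\<Sum>i<N. \<bar>tent (t i) (t (Suc i)) s - tent (t i) (t (Suc i)) s'\<bar>)"
    unfolding tents_def sum_subtractf[symmetric] by (rule sum_abs)
  then show ?thesis using sum_abs_tent_diff_le[OF assms, of s s' N] by linarith
qed

lemma tents_square:
  assumes "mono t" shows "(tents t N s)\<^sup>2 = (\<Sum>i<N. (tent (t i) (t (Suc i)) s)\<^sup>2)"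
proof -
  have "(tents t N s)\<^sup>2 = (\<Sum>i<N. \<Sum>j<N. tent (t i) (t (Suc i)) s * tent (t j) (t (Suc j)) s)"
    by (simp add: tents_def power2_eq_square sum_product)
  also have "\<dots> = (\<Sum>i<N. \<Sum>j<N. if j = i then (tent (t i) (t (Suc i)) s)\<^sup>2 else 0)"
    by (intro sum.cong refl) (auto simp: tent_disjoint[OF assms] power2_eq_square)
  finally show ?thesis by simp
qed

lemma tents_primitive_deriv:
  assumes "mono t" shows "(tents_primitive t N has_real_derivative tents t N s) (at s)"
  unfolding tents_primitive_def[abs_def] tents_def
  by (intro DERIV_sum tent_primitive_deriv monoD[OF assms]) simp

lemma tents_primitive_0:
  assumes "mono t" "s \<le> t 0" shows "tents_primitive t N s = 0"
  unfolding tents_primitive_def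
proof (intro sum.neutral ballI tent_primitive_left)
  fix i show "t i \<le> t (Suc i)" "s \<le> t i"
    using monoD[OF assms(1), of i "Suc i"] monoD[OF assms(1), of 0 i] assms(2) by auto
qed

text \<open>Over an initial piece of length \<open>d\<close> of its interval, the primitive of a tent grows by at least
  \<open>d\<^sup>2 / 4\<close>, and by Cauchy-Schwarz \<open>N\<close> lengths with sum \<open>s\<close> have a sum of squares of at least \<open>s\<^sup>2 / N\<close>.\<close>

lemma tents_primitive_ge:
  assumes "mono t" "t 0 = 0" "0 \<le> s" "s \<le> t N"
  shows "s\<^sup>2 \<le> 4 * real N * tents_primitive t N s"
proof -
  have "s = (\<Sum>i<N. clamp_to (t i) (t (Suc i)) s - t i)"
    using assms by (simp add: sum_clamp_to) (simp add: clamp_to_def)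
  then have "s\<^sup>2 \<le> (\<Sum>i<N. (clamp_to (t i) (t (Suc i)) s - t i)\<^sup>2) * real N"
    using sum_squared_le_sum_of_squares[of "\<lambda>i. clamp_to (t i) (t (Suc i)) s - t i" "{..<N}"] by simp
  also have "\<dots> \<le> (\<Sum>i<N. 4 * tent_primitive (t i) (t (Suc i)) s) * real N"
  proof (intro mult_right_mono sum_mono)
    fix i
    show "(clamp_to (t i) (t (Suc i)) s - t i)\<^sup>2 \<le> 4 * tent_primitive (t i) (t (Suc i)) s"
      using tent_primitive_ge[OF monoD[OF assms(1)], of i "Suc i" s] by simp
  qed simp
  finally show ?thesis by (simp add: tents_primitive_def sum_distrib_left[symmetric] mult_ac)
qed

lemma lipschitz_increment_right:
  fixes H \<eta> :: "real \<Rightarrow> real"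
  assumes H: "\<And>s. (H has_real_derivative \<eta> s) (at s)"
    and lip: "\<And>s t. \<bar>\<eta> s - \<eta> t\<bar> \<le> \<bar>s - t\<bar>" and "a \<le> b"
  shows "H b - H a \<le> \<eta> a * (b - a) + (b - a)\<^sup>2 / 2"
proof -
  let ?p = "\<lambda>s. \<eta> a * (s - a) + (s - a)\<^sup>2 / 2 - H s"
  have "?p a \<le> ?p b"
  proof (rule DERIV_nonneg_imp_nondecreasing[OF \<open>a \<le> b\<close>])
    fix s assume s: "a \<le> s" "s \<le> b"
    have "(?p has_real_derivative \<eta> a + (s - a) - \<eta> s) (at s)"
      by (auto intro!: derivative_eq_intros H)
    moreover have "\<eta> a + (s - a) - \<eta> s \<ge> 0" using lip[of s a] s by linarith
    ultimately show "\<exists>y. (?p has_real_derivative y) (at s) \<and> y \<ge> 0" by blast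
  qed
  then show ?thesis by simp
qed

text \<open>Bound the increment from each end up to the midpoint, where the derivative exceeds its value at the
  nearer end by at most the distance to it. The two halves of length \<open>\<bar>a - b\<bar> / 2\<close> produce the
  constant \<open>1 / 4\<close>.\<close>

lemma lipschitz_increment:
  fixes H \<eta> :: "real \<Rightarrow> real"
  assumes H: "\<And>s. (H has_real_derivative \<eta> s) (at s)"
    and lip: "\<And>s t. \<bar>\<eta> s - \<eta> t\<bar> \<le> \<bar>s - t\<bar>" and nonneg: "\<And>s. \<eta> s \<ge> 0"
  shows "\<bar>H a - H b\<bar> \<le> \<bar>a - b\<bar> * (\<eta> a + \<eta> b) / 2 + (a - b)\<^sup>2 / 4"
proof -
  have *: "\<bar>H a - H b\<bar> \<le> (b - a) * (\<eta> a + \<eta> b) / 2 + (b - a)\<^sup>2 / 4" if "a \<le> b" for a b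
  proof -
    define m where "m = (a + b) / 2"
    have m: "a \<le> m" "m \<le> b" "m - a = (b - a) / 2" "b - m = (b - a) / 2"
      unfolding m_def using that by (auto simp: field_simps)
    have "H a \<le> H b" using that by (rule DERIV_nonneg_imp_nondecreasing) (use H nonneg in blast)
    moreover have "H m - H a \<le> \<eta> a * (m - a) + (m - a)\<^sup>2 / 2"
      by (rule lipschitz_increment_right[OF H lip m(1)])
    \<comment> \<open>The right half is the left half for the reflected functions.\<close>
    moreover have "(- H (- (- m))) - (- H (- (- b))) \<le> \<eta> (- (- b)) * ((- m) - (- b)) + ((- m) - (- b))\<^sup>2 / 2"
    proof (rule lipschitz_increment_right[of "\<lambda>s. - H (- s)" "\<lambda>s. \<eta> (- s)" "- b" "- m"])
      show "((\<lambda>s. - H (- s)) has_real_derivative \<eta> (- s)) (at s)" for s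
        using DERIV_minus[OF DERIV_chain2[OF H[of "- s"] DERIV_minus[OF DERIV_ident]]] by simp
      show "\<bar>\<eta> (- s) - \<eta> (- t)\<bar> \<le> \<bar>s - t\<bar>" for s t using lip[of "- s" "- t"] by simp
    qed (use m in simp)
    then have "H b - H m \<le> \<eta> b * (b - m) + (b - m)\<^sup>2 / 2" by simp
    ultimately have "\<bar>H a - H b\<bar> \<le> \<eta> a * ((b - a) / 2) + ((b - a) / 2)\<^sup>2 / 2
        + (\<eta> b * ((b - a) / 2) + ((b - a) / 2)\<^sup>2 / 2)"
      unfolding m by linarith
    then show ?thesis by (simp add: power_divide field_simps)
  qed
  show ?thesis
  proof (cases "a \<le> b")
    case True
    then show ?thesis using *[OF True] by (simp add: power2_commute)
  next
    case False
    then have "b \<le> a" by simp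
    from *[OF this] show ?thesis using False by (simp add: abs_minus_commute add.commute)
  qed
qed

text \<open>Greedy choice of thresholds: advance until the quantity \<open>F\<close> of the current interval reaches \<open>C\<close>,
  by the intermediate value theorem, or until the end \<open>M\<close> is reached.\<close>

lemma thresholds_exist:
  fixes F :: "real \<Rightarrow> real \<Rightarrow> real"
  assumes cont: "\<And>a. continuous_on UNIV (F a)" and diag: "\<And>a. F a a = 0"
    and C: "C > 0" and M: "M \<ge> 0"
  obtains t where "mono t" "t 0 = 0" "\<And>i. t i \<le> M"
    "\<And>i. F (t i) (t (Suc i)) = C \<or> t (Suc i) = M \<and> F (t i) M \<le> C"
proof -
  have "\<exists>b. a \<le> b \<and> b \<le> M \<and> (F a b = C \<or> b = M \<and> F a M \<le> C)" if "a \<le> M" for a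
  proof (cases "F a M \<le> C")
    case True then show ?thesis using that by blast
  next
    case False
    then have "\<exists>b\<ge>a. b \<le> M \<and> F a b = C"
      using that C diag continuous_on_subset[OF cont]
      by (intro IVT') auto
    then show ?thesis by blast
  qed
  then obtain nxt where nxt: "\<And>a. a \<le> M \<Longrightarrow> a \<le> nxt a \<and> nxt a \<le> M \<and>
      (F a (nxt a) = C \<or> nxt a = M \<and> F a M \<le> C)" by metis
  define t where "t i = (nxt ^^ i) 0" for i
  have tM: "t i \<le> M" for i by (induction i) (use M nxt in \<open>auto simp: t_def\<close>)
  have tS: "t (Suc i) = nxt (t i)" for i by (simp add: t_def)
  show thesis
  proof (rule that)
    show "mono t" unfolding mono_iff_le_Suc using nxt tM tS by simp
    show "t 0 = 0" by (simp add: t_def)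
    show "t i \<le> M" for i by (rule tM)
    show "F (t i) (t (Suc i)) = C \<or> t (Suc i) = M \<and> F (t i) M \<le> C" for i
      using nxt[OF tM[of i]] by (simp add: tS)
  qed
qed

section \<open>The improved Cheeger inequality\<close>

lemma sum_squares_le_square_sum_abs:
  fixes a :: "'i \<Rightarrow> real"
  assumes "finite I" shows "(\<Sum>i\<in>I. (a i)\<^sup>2) \<le> (\<Sum>i\<in>I. \<bar>a i\<bar>)\<^sup>2"
proof -
  have "(\<Sum>i\<in>I. (a i)\<^sup>2) \<le> (\<Sum>i\<in>I. \<bar>a i\<bar> * (\<Sum>j\<in>I. \<bar>a j\<bar>))"
  proof (rule sum_mono)
    fix i assume "i \<in> I"
    then have "\<bar>a i\<bar> \<le> (\<Sum>j\<in>I. \<bar>a j\<bar>)" using assms by (intro member_le_sum) auto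
    then have "\<bar>a i\<bar> * \<bar>a i\<bar> \<le> \<bar>a i\<bar> * (\<Sum>j\<in>I. \<bar>a j\<bar>)" by (intro mult_left_mono) auto
    then show "(a i)\<^sup>2 \<le> \<bar>a i\<bar> * (\<Sum>j\<in>I. \<bar>a j\<bar>)" by (simp add: power2_eq_square)
  qed
  then show ?thesis by (simp add: power2_eq_square sum_distrib_right)
qed

context connected_weighted_graph
begin

text \<open>Peel off the lowest positive level of \<open>h\<close>: with \<open>A = {h > 0}\<close> and \<open>c\<close> the least value of \<open>h\<close>
  on \<open>A\<close>, both sides are additive under \<open>h = (h - c 1\<^sub>A) + c 1\<^sub>A\<close>, and the support of the first
  summand is smaller.\<close>

lemma coarea:
  assumes nonneg: "\<And>x. h x \<ge> 0"
    and iso: "\<And>A. A \<subseteq> {x. 0 < h x} \<Longrightarrow> \<kappa> * sum \<mu> A \<le> tv (indicat_real A)"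
  shows "\<kappa> * (\<Sum>x\<in>UNIV. \<mu> x * h x) \<le> tv h"
  using assms
proof (induction "card {x. 0 < h x}" arbitrary: h rule: less_induct)
  case less
  define A where "A = {x. 0 < h x}"
  show ?case
  proof (cases "A = {}")
    case True
    then have "h x = 0" for x using less.prems(1)[of x] unfolding A_def by (metis empty_iff mem_Collect_eq order_le_less)
    then show ?thesis by (simp add: tv_def)
  next
    case False
    define c where "c = Min (h ` A)"
    have cA: "c \<in> h ` A" unfolding c_def using False by (intro Min_in) auto
    then have c: "c > 0" unfolding A_def by auto
    have cle: "c \<le> h x" if "x \<in> A" for x unfolding c_def using that by (intro Min_le) auto
    have h0: "h x = 0" if "x \<notin> A" for x
      using that less.prems(1)[of x] unfolding A_def by simp
    define h' where "h' x = h x - c * indicat_real A x" for x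
    have nn: "h' x \<ge> 0" for x
      using cle h0 by (cases "x \<in> A") (auto simp: h'_def)
    obtain z where z: "z \<in> A" "h z = c" using cA by blast
    then have zz: "h' z = 0" by (simp add: h'_def)
    have sub: "{x. 0 < h' x} \<subset> A"
    proof
      show "{x. 0 < h' x} \<subseteq> A" using h0 by (auto simp: h'_def indicator_def split: if_splits)
      show "{x. 0 < h' x} \<noteq> A" using z zz by auto
    qed
    then have "card {x. 0 < h' x} < card A" by (intro psubset_card_mono) auto
    then have IH: "\<kappa> * (\<Sum>x\<in>UNIV. \<mu> x * h' x) \<le> tv h'"
      using less.hyps[of h'] nn less.prems(2) sub unfolding A_def by (meson order_trans psubset_imp_subset)
    have "\<bar>h x - h y\<bar> = \<bar>h' x - h' y\<bar> + c * \<bar>indicat_real A x - indicat_real A y\<bar>" for x y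
      using cle[of x] cle[of y] h0[of x] h0[of y] c
      by (cases "x \<in> A"; cases "y \<in> A") (auto simp: h'_def)
    then have tvh: "tv h = tv h' + c * tv (indicat_real A)"
      by (simp add: tv_def distrib_left sum.distrib add_divide_distrib sum_distrib_left mult.left_commute)
    have "(\<Sum>x\<in>UNIV. \<mu> x * indicat_real A x) = sum \<mu> A"
      by (simp add: indicator_def sum.If_cases if_distrib cong: if_cong)
    moreover have "\<mu> x * h x = \<mu> x * h' x + c * (\<mu> x * indicat_real A x)" for x
      by (simp add: h'_def algebra_simps)
    ultimately have muh: "(\<Sum>x\<in>UNIV. \<mu> x * h x) = (\<Sum>x\<in>UNIV. \<mu> x * h' x) + c * sum \<mu> A"
      by (simp add: sum.distrib sum_distrib_left[symmetric])
    have "c * (\<kappa> * sum \<mu> A) \<le> c * tv (indicat_real A)"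
      using less.prems(2)[of A] c unfolding A_def by (intro mult_left_mono) auto
    then show ?thesis unfolding tvh muh using IH by (simp add: algebra_simps)
  qed
qed

lemma degree_le: "(\<Sum>y\<in>UNIV. w x y) \<le> D_non adj w \<mu> * \<mu> x"
proof -
  have "(\<Sum>y\<in>{y. adj y x}. w x y) / \<mu> x \<le> D_non adj w \<mu>"
    unfolding D_non_def by (intro Max_ge) auto
  then show ?thesis using sum_adj[of x "\<lambda>_. 1"] \<mu>_pos[of x] by (simp add: field_simps)
qed

lemma D_non_pos:
  assumes "2 \<le> CARD('v)" shows "0 < D_non adj w \<mu>"
proof -
  obtain x y where xy: "0 < w x y" using edge_exists[OF assms] by blast
  then have "0 < (\<Sum>y\<in>UNIV. w x y)" using w_nonneg by (intro sum_pos2[of _ y]) auto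
  then have "0 < D_non adj w \<mu> * \<mu> x" using degree_le[of x] by linarith
  then show ?thesis using \<mu>_pos[of x] by (simp add: zero_less_mult_iff)
qed

text \<open>Every vertex is counted once for each incident edge and each of the two orientations.\<close>

lemma sum_edge_ends_le:
  assumes "\<And>x. a x \<ge> 0"
  shows "(\<Sum>x\<in>UNIV. \<Sum>y\<in>UNIV. w x y * (a x + a y)) \<le> 2 * D_non adj w \<mu> * (\<Sum>x\<in>UNIV. \<mu> x * a x)"
proof -
  have "(\<Sum>x\<in>UNIV. \<Sum>y\<in>UNIV. w x y * (a x + a y)) = 2 * (\<Sum>x\<in>UNIV. \<Sum>y\<in>UNIV. w x y * a x)"
    using swap_w[of "\<lambda>x y. a y"] by (simp add: distrib_left sum.distrib)
  also have "\<dots> = 2 * (\<Sum>x\<in>UNIV. (\<Sum>y\<in>UNIV. w x y) * a x)" by (simp add: sum_distrib_right)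
  also have "\<dots> \<le> 2 * (\<Sum>x\<in>UNIV. D_non adj w \<mu> * \<mu> x * a x)"
    using assms degree_le by (intro mult_left_mono sum_mono mult_right_mono) auto
  finally show ?thesis by (simp add: sum_distrib_left mult_ac)
qed

lemma twice_energy: "2 * energy f f = (\<Sum>x\<in>UNIV. \<Sum>y\<in>UNIV. w x y * (f x - f y)\<^sup>2)"
  by (simp add: energy_def power2_eq_square)

lemma energy_le_D_non: "energy g g \<le> 2 * D_non adj w \<mu> * inprod g g"
proof -
  have "w x y * ((g x - g y) * (g x - g y)) \<le> w x y * (2 * (g x)\<^sup>2 + 2 * (g y)\<^sup>2)" for x y
  proof (intro mult_left_mono w_nonneg)
    have "0 \<le> (g x + g y)\<^sup>2" by simp
    then show "(g x - g y) * (g x - g y) \<le> 2 * (g x)\<^sup>2 + 2 * (g y)\<^sup>2"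
      by (simp add: power2_eq_square algebra_simps)
  qed
  then have "2 * energy g g \<le> (\<Sum>x\<in>UNIV. \<Sum>y\<in>UNIV. w x y * (2 * (g x)\<^sup>2 + 2 * (g y)\<^sup>2))"
    unfolding energy_def by (simp add: sum_mono)
  also have "\<dots> \<le> 2 * D_non adj w \<mu> * (\<Sum>x\<in>UNIV. \<mu> x * (2 * (g x)\<^sup>2))"
    by (rule sum_edge_ends_le) simp
  also have "\<dots> = 2 * (2 * D_non adj w \<mu> * inprod g g)"
    by (simp add: inprod_def sum_distrib_left power2_eq_square mult_ac)
  finally show ?thesis by (simp add: mult_ac)
qed

lemma eigenvalue_le_D_non:
  assumes "1 \<le> k" "k \<le> CARD('v)" shows "eigenvalue adj w \<mu> k \<le> 2 * D_non adj w \<mu>"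
proof -
  obtain f x where f: "\<And>x. lap f x = - eigenvalue adj w \<mu> k * f x" "f x \<noteq> 0"
    using eigenvalue_has_eigenfunction[OF assms] by metis
  have "eigenvalue adj w \<mu> k * inprod f f \<le> 2 * D_non adj w \<mu> * inprod f f"
    using eigenfunction_energy[OF f(1), of f] energy_le_D_non[of f] by simp
  then show ?thesis using inprod_pos[of f, OF f(2)] by simp
qed

text \<open>At most one of the functions is nonzero at each end of an edge, so at most two terms contribute to
  the difference across it; the factor \<open>2\<close> is Cauchy-Schwarz for two terms.\<close>

lemma energy_disjoint_le:
  assumes fin: "finite I" and disj: "\<And>i j x. i \<in> I \<Longrightarrow> j \<in> I \<Longrightarrow> i \<noteq> j \<Longrightarrow> g i x * g j x = 0"
  shows "energy (\<lambda>x. \<Sum>i\<in>I. c i * g i x) (\<lambda>x. \<Sum>i\<in>I. c i * g i x)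
    \<le> 2 * (\<Sum>i\<in>I. (c i)\<^sup>2 * energy (g i) (g i))"
proof -
  have edge: "(\<Sum>i\<in>I. c i * (g i x - g i y))\<^sup>2 \<le> 2 * (\<Sum>i\<in>I. (c i * (g i x - g i y))\<^sup>2)" for x y
  proof -
    define S where "S z = {i\<in>I. g i z \<noteq> 0}" for z
    have fS: "finite (S z)" for z using fin by (simp add: S_def)
    have cS: "card (S z) \<le> 1" for z
    proof -
      have "i = j" if "i \<in> S z" "j \<in> S z" for i j using that disj[of i j z] unfolding S_def by auto
      then show ?thesis using fS by (simp add: card_le_Suc0_iff_eq)
    qed
    have "card (S x \<union> S y) \<le> 2" using card_Un_le[of "S x" "S y"] cS[of x] cS[of y] by linarith
    then have c2: "real (card (S x \<union> S y)) \<le> 2" by simp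
    have mono: "(\<Sum>i\<in>I. c i * (g i x - g i y)) = (\<Sum>i\<in>S x \<union> S y. c i * (g i x - g i y))"
      "(\<Sum>i\<in>I. (c i * (g i x - g i y))\<^sup>2) = (\<Sum>i\<in>S x \<union> S y. (c i * (g i x - g i y))\<^sup>2)"
      using fin by (auto intro!: sum.mono_neutral_right simp: S_def)
    have "(\<Sum>i\<in>S x \<union> S y. c i * (g i x - g i y))\<^sup>2
        \<le> (\<Sum>i\<in>S x \<union> S y. (c i * (g i x - g i y))\<^sup>2) * real (card (S x \<union> S y))"
      by (rule sum_squared_le_sum_of_squares)
    also have "\<dots> \<le> (\<Sum>i\<in>S x \<union> S y. (c i * (g i x - g i y))\<^sup>2) * 2"
      using c2 by (intro mult_left_mono sum_nonneg) auto
    finally show ?thesis unfolding mono by simp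
  qed
  have "2 * energy (\<lambda>x. \<Sum>i\<in>I. c i * g i x) (\<lambda>x. \<Sum>i\<in>I. c i * g i x)
      = (\<Sum>x\<in>UNIV. \<Sum>y\<in>UNIV. w x y * (\<Sum>i\<in>I. c i * (g i x - g i y))\<^sup>2)"
    unfolding energy_def by (simp add: power2_eq_square right_diff_distrib sum_subtractf)
  also have "\<dots> \<le> (\<Sum>x\<in>UNIV. \<Sum>y\<in>UNIV. w x y * (2 * (\<Sum>i\<in>I. (c i * (g i x - g i y))\<^sup>2)))"
    by (intro sum_mono mult_left_mono edge w_nonneg)
  also have "\<dots> = (\<Sum>x\<in>UNIV. \<Sum>y\<in>UNIV. \<Sum>i\<in>I. 2 * (c i)\<^sup>2 * (w x y * ((g i x - g i y) * (g i x - g i y))))"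
    unfolding sum_distrib_left
    by (intro sum.cong refl) (simp only: power_mult_distrib power2_eq_square mult_ac)
  also have "\<dots> = (\<Sum>x\<in>UNIV. \<Sum>i\<in>I. \<Sum>y\<in>UNIV. 2 * (c i)\<^sup>2 * (w x y * ((g i x - g i y) * (g i x - g i y))))"
    by (intro sum.cong refl sum.swap)
  also have "\<dots> = (\<Sum>i\<in>I. \<Sum>x\<in>UNIV. \<Sum>y\<in>UNIV. 2 * (c i)\<^sup>2 * (w x y * ((g i x - g i y) * (g i x - g i y))))"
    by (rule sum.swap)
  also have "\<dots> = (\<Sum>i\<in>I. 2 * (c i)\<^sup>2 * (2 * energy (g i) (g i)))"
    by (simp add: energy_def sum_distrib_left[symmetric])
  also have "\<dots> = 2 * (2 * (\<Sum>i\<in>I. (c i)\<^sup>2 * energy (g i) (g i)))"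
    by (simp add: sum_distrib_left mult_ac)
  finally show ?thesis by simp
qed

lemma sum_energy_tents_le:
  assumes "mono t"
  shows "(\<Sum>i<N. energy (\<lambda>x. tent (t i) (t (Suc i)) (f x)) (\<lambda>x. tent (t i) (t (Suc i)) (f x)))
    \<le> energy f f"
proof -
  let ?g = "\<lambda>i x. tent (t i) (t (Suc i)) (f x)"
  have edge: "(\<Sum>i<N. (?g i x - ?g i y)\<^sup>2) \<le> (f x - f y)\<^sup>2" for x y
  proof -
    have "(\<Sum>i<N. (?g i x - ?g i y)\<^sup>2) \<le> (\<Sum>i<N. \<bar>?g i x - ?g i y\<bar>)\<^sup>2"
      by (rule sum_squares_le_square_sum_abs) simp
    also have "\<dots> \<le> \<bar>f x - f y\<bar>\<^sup>2"
      by (intro power_mono sum_abs_tent_diff_le[OF assms] sum_nonneg) auto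
    finally show ?thesis by simp
  qed
  have "2 * (\<Sum>i<N. energy (?g i) (?g i))
      = (\<Sum>i<N. \<Sum>x\<in>UNIV. \<Sum>y\<in>UNIV. w x y * (?g i x - ?g i y)\<^sup>2)"
    by (simp only: sum_distrib_left twice_energy)
  also have "\<dots> = (\<Sum>x\<in>UNIV. \<Sum>i<N. \<Sum>y\<in>UNIV. w x y * (?g i x - ?g i y)\<^sup>2)"
    by (rule sum.swap)
  also have "\<dots> = (\<Sum>x\<in>UNIV. \<Sum>y\<in>UNIV. \<Sum>i<N. w x y * (?g i x - ?g i y)\<^sup>2)"
    by (intro sum.cong refl sum.swap)
  also have "\<dots> = (\<Sum>x\<in>UNIV. \<Sum>y\<in>UNIV. w x y * (\<Sum>i<N. (?g i x - ?g i y)\<^sup>2))"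
    by (simp add: sum_distrib_left)
  also have "\<dots> \<le> (\<Sum>x\<in>UNIV. \<Sum>y\<in>UNIV. w x y * (f x - f y)\<^sup>2)"
    by (intro sum_mono mult_left_mono edge w_nonneg)
  also have "\<dots> = 2 * energy f f" by (simp add: energy_def power2_eq_square)
  finally show ?thesis by simp
qed

text \<open>If \<open>f\<close> has a small Rayleigh quotient compared to the \<open>k\<close>-th eigenvalue, it is close to a step
  function with few values: the weighted sum on the left is its squared distance to the thresholds.
  Otherwise the greedy choice would yield \<open>2 k\<close> tents over \<open>f\<close> with disjoint supports and equal
  norms. Their energies add up to at most that of \<open>f\<close>, so at least \<open>k\<close> of them carry at most
  \<open>1 / (k + 1)\<close> of the bound for it, and these contradict Courant-Fischer.\<close>

lemma thresholds_with_small_error: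
  assumes k: "1 \<le> k" "k \<le> CARD('v)" and L: "eigenvalue adj w \<mu> k > 0"
    and nonneg: "\<And>x. f x \<ge> 0" and norm: "inprod f f > 0"
    and ray: "energy f f \<le> l * inprod f f" and l: "l > 0"
  obtains t where "mono t" "t 0 = 0" "\<And>x. f x \<le> t (2 * k)"
    "(\<Sum>x\<in>UNIV. \<mu> x * (tents t (2 * k) (f x))\<^sup>2) \<le> 4 * l * inprod f f / eigenvalue adj w \<mu> k"
proof -
  define L where "L = eigenvalue adj w \<mu> k"
  define M where "M = Max (range f)"
  define C where "C = 2 * l * inprod f f / (real k * L)"
  define F where "F a b = (\<Sum>x\<in>UNIV. \<mu> x * (tent a b (f x))\<^sup>2)" for a b
  have Lpos: "L > 0" using L by (simp add: L_def)
  have C: "C > 0" unfolding C_def using norm l k Lpos by simp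
  have fM: "f x \<le> M" for x unfolding M_def by (intro Max_ge) auto
  then have M: "M \<ge> 0" using nonneg order_trans by blast
  have cont: "continuous_on UNIV (F a)" for a
    unfolding F_def[abs_def] tent_def by (intro continuous_intros)
  have "tent a a z = 0" for a z by (auto simp: tent_def min_def max_def)
  then have diag: "F a a = 0" for a by (simp add: F_def)
  obtain t where t: "mono t" "t 0 = 0" "\<And>i. t i \<le> M"
    and tF: "\<And>i. F (t i) (t (Suc i)) = C \<or> t (Suc i) = M \<and> F (t i) M \<le> C"
    using thresholds_exist[of F C M] cont diag C M by blast
  define g where "g i x = tent (t i) (t (Suc i)) (f x)" for i x
  have gg: "inprod (g i) (g i) = F (t i) (t (Suc i))" for i
    by (simp add: inprod_def g_def F_def power2_eq_square mult_ac)
  have disj: "g i x * g j x = 0" if "i \<noteq> j" for i j x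
    unfolding g_def using tent_disjoint[OF t(1) that] .
  have "\<exists>i<2 * k. F (t i) (t (Suc i)) \<noteq> C"
  proof (rule ccontr)
    assume "\<not> ?thesis"
    then have full: "inprod (g i) (g i) = C" if "i < 2 * k" for i using that gg by simp
    \<comment> \<open>At most \<open>k\<close> of the tents can have energy above this, and the denominator \<open>k + 1\<close> instead of
      \<open>k\<close> makes the final inequality strict.\<close>
    define B where "B = l * inprod f f / (real k + 1)"
    have B: "B > 0" unfolding B_def using l norm by simp
    define I where "I = {i\<in>{..<2 * k}. energy (g i) (g i) \<le> B}"
    define J where "J = {i\<in>{..<2 * k}. \<not> energy (g i) (g i) \<le> B}"
    have fin: "finite I" "finite J" unfolding I_def J_def by auto
    have "card I + card J = card (I \<union> J)"
      using fin by (intro card_Un_disjoint[symmetric]) (auto simp: I_def J_def)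
    also have "I \<union> J = {..<2 * k}" unfolding I_def J_def by auto
    finally have IJ: "card I + card J = 2 * k" by simp
    have "k \<le> card I"
    proof (rule ccontr)
      assume "\<not> k \<le> card I"
      then have J: "k + 1 \<le> card J" using IJ by linarith
      then have "J \<noteq> {}" by auto
      have "real (card J) * B = (\<Sum>i\<in>J. B)" by simp
      also have "\<dots> < (\<Sum>i\<in>J. energy (g i) (g i))"
        using fin \<open>J \<noteq> {}\<close> by (intro sum_strict_mono) (auto simp: J_def)
      also have "\<dots> \<le> (\<Sum>i<2 * k. energy (g i) (g i))"
        by (intro sum_mono2) (auto simp: J_def energy_nonneg)
      also have "\<dots> \<le> energy f f"
        unfolding g_def by (rule sum_energy_tents_le[OF t(1)])
      also have "\<dots> \<le> (real k + 1) * B" using ray by (simp add: B_def)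
      finally have "real (card J) < real k + 1" using B by simp
      then show False using J by simp
    qed
    have "L \<le> 2 * B / C"
      unfolding L_def
    proof (rule eigenvalue_le_of_orthogonal_family[where I = I and g = g])
      show "inprod (g i) (g j) = 0" if "i \<noteq> j" for i j
        by (simp add: inprod_def mult.assoc disj[OF that])
      show "inprod (g i) (g i) > 0" if "i \<in> I" for i using full[of i] that C by (simp add: I_def)
      fix c :: "nat \<Rightarrow> real"
      have "energy (\<lambda>x. \<Sum>i\<in>I. c i * g i x) (\<lambda>x. \<Sum>i\<in>I. c i * g i x)
          \<le> 2 * (\<Sum>i\<in>I. (c i)\<^sup>2 * energy (g i) (g i))"
        by (intro energy_disjoint_le fin disj)
      also have "\<dots> \<le> 2 * (\<Sum>i\<in>I. (c i)\<^sup>2 * B)"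
        by (intro mult_left_mono sum_mono) (auto simp: I_def)
      also have "\<dots> = 2 * B / C * (\<Sum>i\<in>I. (c i)\<^sup>2 * C)"
        using C by (simp add: sum_distrib_right[symmetric])
      also have "(\<Sum>i\<in>I. (c i)\<^sup>2 * C) = (\<Sum>i\<in>I. (c i)\<^sup>2 * inprod (g i) (g i))"
        using full by (intro sum.cong) (auto simp: I_def)
      finally show "energy (\<lambda>x. \<Sum>i\<in>I. c i * g i x) (\<lambda>x. \<Sum>i\<in>I. c i * g i x)
          \<le> 2 * B / C * (\<Sum>i\<in>I. (c i)\<^sup>2 * inprod (g i) (g i))" .
    qed (use k \<open>k \<le> card I\<close> fin in auto)
    also have "2 * B / C = L * (real k / (real k + 1))"
    proof -
      have "2 * (q / m) / (2 * q / (a * L)) = L * (a / m)" if "q > 0" "m > 0" "a > 0" for q m a :: real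
        using that Lpos by (simp add: field_simps)
      from this[of "l * inprod f f" "real k + 1" "real k"] show ?thesis
        unfolding B_def C_def using l norm k by (simp add: mult.assoc)
    qed
    also have "\<dots> < L * 1" using Lpos by (intro mult_strict_left_mono) auto
    finally show False by simp
  qed
  then obtain i where i: "i < 2 * k" "t (Suc i) = M" using tF by blast
  have "t (Suc i) \<le> t (2 * k)" using i by (intro monoD[OF t(1)]) simp
  then have tk: "t (2 * k) = M" using i t(3)[of "2 * k"] by simp
  have FC: "F (t i) (t (Suc i)) \<le> C" for i using tF[of i] by auto
  have "(\<Sum>x\<in>UNIV. \<mu> x * (tents t (2 * k) (f x))\<^sup>2) = (\<Sum>i<2 * k. F (t i) (t (Suc i)))"
    unfolding tents_square[OF t(1)] F_def sum_distrib_left by (rule sum.swap)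
  also have "\<dots> \<le> (\<Sum>i<2 * k. C)" by (intro sum_mono FC)
  also have "\<dots> = 4 * l * inprod f f / L" using k Lpos by (simp add: C_def field_simps)
  finally show thesis using that[of t] t fM by (simp add: tk L_def)
qed

text \<open>A function of \<open>f\<close> with slope \<open>\<eta>\<close> has its variation controlled by the energy of \<open>f\<close> and the
  squared norm of \<open>\<eta>\<close> along \<open>f\<close>. The parameter \<open>s\<close> stands for the optimisation in the
  Cauchy-Schwarz inequality.\<close>

lemma tv_primitive_le:
  assumes s: "s > 0"
    and H: "\<And>z. (H has_real_derivative \<eta> z) (at z)"
    and lip: "\<And>z z'. \<bar>\<eta> z - \<eta> z'\<bar> \<le> \<bar>z - z'\<bar>" and nonneg: "\<And>z. \<eta> z \<ge> 0"
  shows "tv (\<lambda>x. H (f x)) \<le> (s / 2 + 1 / 4) * energy f f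
    + D_non adj w \<mu> / (4 * s) * (\<Sum>x\<in>UNIV. \<mu> x * (\<eta> (f x))\<^sup>2)"
proof -
  define e where "e x = \<eta> (f x)" for x
  have edge: "\<bar>H (f x) - H (f y)\<bar>
      \<le> (s / 2 + 1 / 4) * (f x - f y)\<^sup>2 + 1 / (4 * s) * ((e x)\<^sup>2 + (e y)\<^sup>2)" for x y
  proof -
    define d where "d = \<bar>f x - f y\<bar>"
    \<comment> \<open>The second square pays for replacing \<open>(e x + e y)\<^sup>2\<close> by \<open>2 (e x)\<^sup>2 + 2 (e y)\<^sup>2\<close>.\<close>
    have "0 \<le> (2 * s * d - (e x + e y))\<^sup>2 + (e x - e y)\<^sup>2" by simp
    then have "s * (4 * (d * (e x + e y))) \<le> s * (4 * (s * d\<^sup>2)) + 2 * ((e x)\<^sup>2 + (e y)\<^sup>2)"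
      by (simp add: power2_eq_square algebra_simps)
    then have "d * (e x + e y) / 2 \<le> s / 2 * d\<^sup>2 + 1 / (4 * s) * ((e x)\<^sup>2 + (e y)\<^sup>2)"
      using s by (simp add: field_simps)
    also have "d\<^sup>2 = (f x - f y)\<^sup>2" by (simp add: d_def)
    finally have "d * (e x + e y) / 2
        \<le> s / 2 * (f x - f y)\<^sup>2 + 1 / (4 * s) * ((e x)\<^sup>2 + (e y)\<^sup>2)" .
    moreover have "\<bar>H (f x) - H (f y)\<bar> \<le> d * (e x + e y) / 2 + (f x - f y)\<^sup>2 / 4"
      unfolding d_def e_def by (rule lipschitz_increment[OF H lip nonneg])
    ultimately have "\<bar>H (f x) - H (f y)\<bar>
        \<le> s / 2 * (f x - f y)\<^sup>2 + 1 / (4 * s) * ((e x)\<^sup>2 + (e y)\<^sup>2) + (f x - f y)\<^sup>2 / 4"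
      by linarith
    then show ?thesis by (simp add: distrib_right)
  qed
  have "2 * tv (\<lambda>x. H (f x)) = (\<Sum>x\<in>UNIV. \<Sum>y\<in>UNIV. w x y * \<bar>H (f x) - H (f y)\<bar>)"
    by (simp add: tv_def)
  also have "\<dots> \<le> (\<Sum>x\<in>UNIV. \<Sum>y\<in>UNIV. w x y *
      ((s / 2 + 1 / 4) * (f x - f y)\<^sup>2 + 1 / (4 * s) * ((e x)\<^sup>2 + (e y)\<^sup>2)))"
    by (intro sum_mono mult_left_mono edge w_nonneg)
  also have "\<dots> = (s / 2 + 1 / 4) * (\<Sum>x\<in>UNIV. \<Sum>y\<in>UNIV. w x y * (f x - f y)\<^sup>2)
      + 1 / (4 * s) * (\<Sum>x\<in>UNIV. \<Sum>y\<in>UNIV. w x y * ((e x)\<^sup>2 + (e y)\<^sup>2))"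
    unfolding sum_distrib_left sum.distrib[symmetric]
    by (intro sum.cong refl) (simp only: distrib_left mult_ac)
  also have "\<dots> \<le> (s / 2 + 1 / 4) * (2 * energy f f)
      + 1 / (4 * s) * (2 * D_non adj w \<mu> * (\<Sum>x\<in>UNIV. \<mu> x * (e x)\<^sup>2))"
    unfolding twice_energy using s
    by (intro add_left_mono mult_left_mono sum_edge_ends_le) auto
  finally show ?thesis unfolding e_def by (simp add: algebra_simps)
qed

text \<open>Apply the coarea inequality to \<open>h = H \<circ> f\<close>, where the slope of \<open>H\<close> is the distance to the
  thresholds. As \<open>f\<close> is close to the thresholds, \<open>h\<close> has little variation, and as there are only
  \<open>2 k\<close> intervals, \<open>h\<close> is still at least \<open>f\<^sup>2 / (8 k)\<close>.\<close>

lemma improved_cheeger: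
  assumes k: "1 \<le> k" "k \<le> CARD('v)" and L: "eigenvalue adj w \<mu> k > 0"
    and nonneg: "\<And>x. f x \<ge> 0" and norm: "inprod f f > 0"
    and ray: "energy f f \<le> l * inprod f f" and l: "l > 0"
    and \<kappa>: "\<kappa> \<ge> 0" and iso: "\<And>A. A \<subseteq> {x. 0 < f x} \<Longrightarrow> \<kappa> * sum \<mu> A \<le> tv (indicat_real A)"
  shows "\<kappa> \<le> 10 * real k * l * sqrt (2 * D_non adj w \<mu> / eigenvalue adj w \<mu> k)"
proof -
  define L where "L = eigenvalue adj w \<mu> k"
  define D where "D = D_non adj w \<mu>"
  define n where "n = inprod f f"
  \<comment> \<open>The value that balances the two terms of the variation bound; \<open>s \<ge> 1\<close> lets the remaining
    term \<open>1 / 4\<close> be absorbed.\<close>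
  define s where "s = sqrt (2 * D / L)"
  have Lpos: "L > 0" using L by (simp add: L_def)
  have LD: "L \<le> 2 * D" unfolding L_def D_def using eigenvalue_le_D_non[OF k] .
  have s1: "s \<ge> 1" unfolding s_def using LD Lpos by simp
  have s2: "s * s = 2 * D / L" unfolding s_def using LD Lpos by simp
  obtain t where t: "mono t" "t 0 = 0" "\<And>x. f x \<le> t (2 * k)"
    and err: "(\<Sum>x\<in>UNIV. \<mu> x * (tents t (2 * k) (f x))\<^sup>2) \<le> 4 * l * n / L"
    using thresholds_with_small_error[OF k L nonneg norm ray l] unfolding n_def L_def by blast
  define h where "h x = tents_primitive t (2 * k) (f x)" for x
  have hge: "(f x)\<^sup>2 \<le> 8 * real k * h x" for x
    using tents_primitive_ge[OF t(1,2) nonneg t(3)] by (simp add: h_def)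
  have hnn: "h x \<ge> 0" for x
  proof -
    have "0 \<le> 8 * real k * h x" using hge[of x] zero_le_power2[of "f x"] by linarith
    then show ?thesis using k by (simp add: zero_le_mult_iff)
  qed
  have "{x. 0 < h x} \<subseteq> {x. 0 < f x}"
  proof
    fix x assume "x \<in> {x. 0 < h x}"
    then have "f x \<noteq> 0" using tents_primitive_0[OF t(1), of 0] t(2) by (auto simp: h_def)
    then show "x \<in> {x. 0 < f x}" using nonneg[of x] by simp
  qed
  then have "\<kappa> * (\<Sum>x\<in>UNIV. \<mu> x * h x) \<le> tv h"
    using iso hnn by (intro coarea) auto
  also have "tv h \<le> (s / 2 + 1 / 4) * energy f f
      + D / (4 * s) * (\<Sum>x\<in>UNIV. \<mu> x * (tents t (2 * k) (f x))\<^sup>2)"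
    unfolding h_def[abs_def] D_def using s1
    by (intro tv_primitive_le tents_primitive_deriv tents_lipschitz tents_nonneg t) simp
  also have "\<dots> \<le> (s / 2 + s / 4) * (l * n) + D / (4 * s) * (4 * l * n / L)"
  proof (intro add_mono mult_mono err)
    show "energy f f \<le> l * n" using ray by (simp add: n_def)
  qed (use s1 LD Lpos energy_nonneg \<mu>_pos in \<open>auto intro!: sum_nonneg simp: less_imp_le\<close>)
  also have "\<dots> = 5 / 4 * (s * l * n)"
  proof -
    have "D / (4 * s) * (4 * l * n / L) = (2 * D / L) / s * (l * n) / 2" using s1 Lpos by simp
    also have "\<dots> = s * l * n / 2" unfolding s2[symmetric] using s1 by simp
    finally have *: "D / (4 * s) * (4 * l * n / L) = s * l * n / 2" .
    show ?thesis unfolding * by (simp add: field_simps)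
  qed
  finally have up: "\<kappa> * (\<Sum>x\<in>UNIV. \<mu> x * h x) \<le> 5 / 4 * (s * l * n)" .
  have "n \<le> 8 * real k * (\<Sum>x\<in>UNIV. \<mu> x * h x)"
  proof -
    have "n = (\<Sum>x\<in>UNIV. \<mu> x * (f x)\<^sup>2)" by (simp add: n_def inprod_def power2_eq_square mult_ac)
    also have "\<dots> \<le> (\<Sum>x\<in>UNIV. \<mu> x * (8 * real k * h x))"
      using \<mu>_pos hge by (intro sum_mono mult_left_mono) (auto simp: less_imp_le)
    finally show ?thesis by (simp add: sum_distrib_left mult_ac)
  qed
  then have "\<kappa> * n \<le> \<kappa> * (8 * real k * (\<Sum>x\<in>UNIV. \<mu> x * h x))"
    using \<kappa> by (rule mult_left_mono)
  also have "\<dots> = 8 * real k * (\<kappa> * (\<Sum>x\<in>UNIV. \<mu> x * h x))" by simp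
  also have "\<dots> \<le> 8 * real k * (5 / 4 * (s * l * n))" using up by (intro mult_left_mono) auto
  finally have "\<kappa> * n \<le> (10 * real k * l * s) * n" by (simp add: mult_ac)
  then show ?thesis using norm unfolding n_def s_def D_def L_def by simp
qed

text \<open>With \<open>p\<close> for the positive part, \<open>(p x - p y)\<^sup>2 \<le> (f x - f y) (p x - p y)\<close> on every edge, so it
  suffices to test the eigenvalue equation with \<open>p\<close>.\<close>

lemma eigenfunction_positive_part:
  assumes ef: "\<And>x. lap f x = - l * f x"
  shows "energy (\<lambda>x. max 0 (f x)) (\<lambda>x. max 0 (f x))
    \<le> l * inprod (\<lambda>x. max 0 (f x)) (\<lambda>x. max 0 (f x))"
proof -
  let ?p = "\<lambda>x. max 0 (f x)"
  have "energy ?p ?p \<le> energy f ?p"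
    unfolding energy_def
    by (intro divide_right_mono sum_mono mult_left_mono w_nonneg)
      (auto simp: max_def algebra_simps mult_nonneg_nonpos mult_nonpos_nonneg)
  also have "\<dots> = l * inprod f ?p" by (rule eigenfunction_energy[OF ef])
  also have "inprod f ?p = inprod ?p ?p"
    unfolding inprod_def by (intro sum.cong refl) (simp add: max_def)
  finally show ?thesis .
qed

text \<open>An eigenfunction for a positive eigenvalue is orthogonal to the constants, so it takes both signs,
  and the sets where it is positive and negative cannot both have more than half of the measure.\<close>

lemma eigenfunction_with_small_positive_support:
  assumes card: "2 \<le> CARD('v)"
  obtains f where "\<And>x. lap f x = - eigenvalue adj w \<mu> 2 * f x" "\<exists>x. 0 < f x"
    "2 * sum \<mu> {x. 0 < f x} \<le> sum \<mu> UNIV"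
proof -
  define l where "l = eigenvalue adj w \<mu> 2"
  have l: "l > 0" unfolding l_def by (rule eigenvalue_2_pos[OF card])
  obtain f where f: "\<And>x. lap f x = - l * f x" "\<exists>x. f x \<noteq> 0"
    unfolding l_def using eigenvalue_has_eigenfunction[of 2] card by auto
  have pos: "\<exists>x. 0 < g x" if g: "\<And>x. lap g x = - l * g x" "\<exists>x. g x \<noteq> 0" for g
  proof (rule ccontr)
    assume "\<nexists>x. 0 < g x"
    then have le: "g x \<le> 0" for x by (simp add: not_less)
    \<comment> \<open>Orthogonality to the constants, which is incompatible with a single sign.\<close>
    have "energy g (\<lambda>_. 1) = 0" by (simp add: energy_def)
    then have "l * inprod g (\<lambda>_. 1) = 0" using eigenfunction_energy[OF g(1)] by simp
    then have "(\<Sum>x\<in>UNIV. \<mu> x * - g x) = 0" using l by (simp add: inprod_def sum_negf)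
    moreover have "\<mu> x * - g x \<ge> 0" for x using le[of x] \<mu>_pos[of x] by (intro mult_nonneg_nonneg) auto
    ultimately have "\<mu> x * - g x = 0" for x by (simp add: sum_nonneg_eq_0_iff)
    then show False using g(2) \<mu>_pos by (metis less_irrefl mult_eq_0_iff neg_equal_0_iff_equal)
  qed
  define P Q where "P = {x. 0 < f x}" and "Q = {x. 0 < - f x}"
  have "sum \<mu> P + sum \<mu> Q = sum \<mu> (P \<union> Q)"
    by (intro sum.union_disjoint[symmetric]) (auto simp: P_def Q_def)
  also have "\<dots> \<le> sum \<mu> UNIV" using \<mu>_pos by (intro sum_mono2) (auto simp: less_imp_le)
  finally consider "2 * sum \<mu> P \<le> sum \<mu> UNIV" | "2 * sum \<mu> Q \<le> sum \<mu> UNIV" by linarith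
  then show thesis
  proof cases
    case 1
    then show thesis using that[of f] f pos[of f] by (simp add: P_def l_def)
  next
    case 2
    have m: "lap (\<lambda>x. - f x) x = - l * - f x" for x
      using lap_scale[of "-1" f x] f(1)[of x] by simp
    have "\<exists>x. 0 < - f x" using pos[of "\<lambda>x. - f x"] m f(2) by simp
    then show thesis using that[of "\<lambda>x. - f x"] m 2 by (simp add: Q_def l_def)
  qed
qed

end

theorem theoremA:
  fixes adj :: "'v::finite \<Rightarrow> 'v \<Rightarrow> bool"
    and w :: "'v \<Rightarrow> 'v \<Rightarrow> real"
    and \<mu> :: "'v \<Rightarrow> real"
    and k :: nat
  assumes "connected_weighted_graph adj w \<mu>"
    and "CD_0_infinity adj w \<mu>"
    and "2 \<le> k" and "k \<le> CARD('v)"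
  shows "eigenvalue adj w \<mu> k
    \<le> (20 * sqrt 2 * exp 1 / (exp 1 - 1))\<^sup>2
        * D_non adj w \<mu> * D_nor adj w \<mu> * (real k)\<^sup>2 * eigenvalue adj w \<mu> 2"
proof -
  interpret connected_weighted_graph adj w \<mu> by fact
  note CD = assms(2)
  have card: "2 \<le> CARD('v)" and k: "1 \<le> k" "k \<le> CARD('v)" using assms(3,4) by auto
  define l where "l = eigenvalue adj w \<mu> 2"
  define L where "L = eigenvalue adj w \<mu> k"
  define D where "D = D_non adj w \<mu>"
  define D' where "D' = D_nor adj w \<mu>"
  define c :: real where "c = (1 - exp (-1)) / 2"
  have l: "l > 0" unfolding l_def by (rule eigenvalue_2_pos[OF card])
  have "l \<le> L" unfolding l_def L_def using assms(3,4) by (intro eigenvalue_mono) auto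
  then have L: "L > 0" using l by linarith
  have D: "D > 0" "D' > 0" unfolding D_def D'_def using D_non_pos[OF card] D_nor_pos[OF card] by auto
  have c: "c > 0" unfolding c_def by simp
  define r where "r = sqrt (D' / l)"
  have r: "r > 0" unfolding r_def using D l by simp
  obtain f where f: "\<And>x. lap f x = - l * f x" "\<exists>x. 0 < f x"
    "2 * sum \<mu> {x. 0 < f x} \<le> sum \<mu> UNIV"
    using eigenfunction_with_small_positive_support[OF card] unfolding l_def by blast
  define p where "p x = max 0 (f x)" for x
  have "c / r \<le> 10 * real k * l * sqrt (2 * D / L)"
    unfolding D_def L_def
  proof (rule improved_cheeger[OF k])
    show "eigenvalue adj w \<mu> k > 0" using L by (simp add: L_def)
    show "p x \<ge> 0" for x by (simp add: p_def)
    obtain x where "0 < f x" using f(2) by blast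
    then show "inprod p p > 0" by (intro inprod_pos[of p x]) (simp add: p_def)
    show "energy p p \<le> l * inprod p p"
      unfolding p_def[abs_def] using f(1) by (rule eigenfunction_positive_part)
    show "l > 0" "c / r \<ge> 0" using l c r by auto
    fix A assume "A \<subseteq> {x. 0 < p x}"
    then have "sum \<mu> A \<le> sum \<mu> {x. 0 < f x}"
      using \<mu>_pos by (intro sum_mono2) (auto simp: p_def less_imp_le split: if_splits)
    then have "2 * sum \<mu> A \<le> sum \<mu> UNIV" using f(3) by linarith
    from buser[OF CD card this]
    have "c * sum \<mu> A \<le> r * tv (indicat_real A)" by (simp add: c_def r_def D'_def l_def)
    then show "c / r * sum \<mu> A \<le> tv (indicat_real A)" using r by (simp add: field_simps)
  qed
  then have "c \<le> 10 * real k * l * sqrt (2 * D / L) * r" using r by (simp add: field_simps)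
  then have "c\<^sup>2 \<le> (10 * real k * l * sqrt (2 * D / L) * r)\<^sup>2" using c by (intro power_mono) auto
  also have "\<dots> = 200 * (real k)\<^sup>2 * l * D * D' / L"
    unfolding r_def using l L D by (simp add: power_mult_distrib power2_eq_square field_simps)
  finally have "L * c\<^sup>2 \<le> 200 * (real k)\<^sup>2 * l * D * D'" using L by (simp add: field_simps)
  then have "L \<le> 200 / c\<^sup>2 * ((real k)\<^sup>2 * l * D * D')" using c by (simp add: field_simps)
  also have "200 / c\<^sup>2 = (20 * sqrt 2 * exp 1 / (exp 1 - 1))\<^sup>2"
  proof -
    have "c = (exp 1 - 1) / (2 * exp 1)" by (simp add: c_def exp_minus field_simps)
    then show ?thesis by (simp add: power_divide power_mult_distrib)
  qed
  finally show ?thesis unfolding L_def l_def D_def D'_def by (simp only: mult_ac)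
qed

end
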